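(* Let $(\boldsymbol\theta_0,\boldsymbol\pi_0)\in\Xi$ and let $X_1,X_2,\dots$ be i.i.d. with density $f(\cdot;(\boldsymbol\theta_0,\boldsymbol\pi_0))$ w.r.t. $[dX]$. Let $\Pi$ be the prior on $\Xi$ described below and $\Pi(\cdot\mid X_1,\dots,X_N)$ the corresponding posterior. Then for every weak neighborhood $\mathcal U$ of $(\boldsymbol\theta_0,\boldsymbol\pi_0)$, $$\Pi(\mathcal U^c\mid X_1,\dots,X_N)\to0\quad\text{almost surely under }F_{\boldsymbol\theta_0,\boldsymbol\pi_0}^\infty\text{ as }N\to\infty.$$
   Context: $\mathcal V_{n,p}=\{X\in\mathbb R^{n\times p}:X^TX=I_p\}$ ($n\ge p$) with normalized Haar probability measure $[dX]$; $\widetilde{\mathcal V}_{n,p}=\{X\in\mathcal V_{n,p}:X_{1j}>0\ \forall j\}$; $\mathcal S_p=\{(d_1,\dots,d_p):0<d_p<\cdots<d_1\}$; ${}_0F_1\!\left(\tfrac n2,\tfrac{D^2}{4}\right)=\int_{\mathcal V_{n,p}}\exp\big(\sum_j d_jX_{jj}\big)[dX]$, $D=\mathrm{diag}(\boldsymbol d)$. $f_{ML}(X;(M,\boldsymbol d,V))=\mathrm{etr}(VDM^TX)/{}_0F_1(\tfrac n2,\tfrac{D^2}4)$. $\boldsymbol\Theta=\widetilde{\mathcal V}_{n,p}^C\times\mathcal S_p^C\times\mathcal V_{p,p}^C$, $\mathbb S_\pi=\{\boldsymbol\pi\in(0,1)^C:\sum_c\pi_c=1\}$, $\Xi=\boldsymbol\Theta\times\mathbb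 S_\pi$, $f(X;(\boldsymbol\theta,\boldsymbol\pi))=\sum_{c=1}^C\pi_cf_{ML}(X;\theta_c)$; $F_{\boldsymbol\theta_0,\boldsymbol\pi_0}$ is the distribution with density $f(\cdot;(\boldsymbol\theta_0,\boldsymbol\pi_0))$ and $F^\infty$ the infinite product measure. Prior $\Pi$: independently across components, $M_c$ has density $\propto\mathrm{etr}(G_c^TM_c)$ (matrix Langevin) on $\widetilde{\mathcal V}_{n,p}$, $V_c$ has density $\propto\mathrm{etr}(H_c^TV_c)$ on $\mathcal V_{p,p}$, $\boldsymbol d_c$ has Lebesgue density on $\mathcal S_p$ proportional to $\exp(\nu_c\boldsymbol\eta_c^T\boldsymbol d_c)/[{}_0F_1(\tfrac n2,\tfrac{D_c^2}4)]^{\nu_c}$ with $\nu_c>0$, $\max_j\eta_{cj}<1$, and $\boldsymbol\pi\sim\mathrm{Dirichlet}(\alpha_1,\dots,\alpha_C)$ with $\alpha_c>0$ (fixed hyperparameters $G_c\in\mathbb R^{n\times p}$, $H_c\in\mathbb R^{p\times p}$). Posterior: $\Pi(A\mid X_{1:N})=\int_A R_N\,d\Pi/\int_\Xi R_N\,d\Pi$ with $R_N(\boldsymbol\theta,\boldsymbol\pi)=\prod_{i=1}^N f(X_i;(\boldsymbol\theta,\boldsymbol\pi))/f(X_i;(\boldsymbol\theta_0,\boldsymbol\pi_0))$. A weak neighborhood of $(\boldsymbol\theta_0,\boldsymbol\pi_0)$ is any subset of $\Xi$ containing a set of the form $\{(\boldsymbol\theta,\boldsymbol\pi):|\int g_i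 f(\cdot;(\boldsymbol\theta_0,\boldsymbol\pi_0))[dX]-\int g_if(\cdot;(\boldsymbol\theta,\boldsymbol\pi))[dX]|<\epsilon,\ i=1,\dots,k\}$ with $\epsilon>0$ and $g_1,\dots,g_k$ bounded continuous functions on $\mathcal V_{n,p}$. *)

theory Defs
  imports "HOL-Probability.Probability"
begin

type_synonym ('n,'p) rmat = "((real,'p) vec,'n) vec"
type_synonym 'p rvec = "(real,'p) vec"

text \<open>Matrices in R^(n x p) are represented as ('n,'p) rmat (rows indexed by 'n,
  columns by 'p).  The index types carry a linear order, which fixes the
  labelling 1,...,n of rows and 1,...,p of columns.\<close>

definition stiefel :: "(('n::{finite,linorder},'p::{finite,linorder}) rmat) set" where
  "stiefel = {X. transpose X ** X = mat 1}"

text \<open>Normalized Haar probability measure on V_{n,p}: a probability measure on the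
  Borel sets, concentrated on V_{n,p}, and invariant under left multiplication by
  orthogonal n x n matrices (such a measure exists and is unique).\<close>

definition haar_stiefel :: "(('n::{finite,linorder},'p::{finite,linorder}) rmat) measure \<Rightarrow> bool" where
  "haar_stiefel \<mu> \<longleftrightarrow>
     sets \<mu> = sets borel \<and> prob_space \<mu> \<and> emeasure \<mu> stiefel = 1 \<and>
     (\<forall>Q::('n,'n) rmat. orthogonal_matrix Q \<longrightarrow> distr \<mu> borel (\<lambda>X. Q ** X) = \<mu>)"

definition rank_of :: "'a::{finite,linorder} \<Rightarrow> nat" where
  "rank_of j = card {k. k < j}"

text \<open>The row index of 'n with the same rank as column j of 'p (the diagonal entry X_jj).\<close>
definition diag_row :: "'p::{finite,linorder} \<Rightarrow> 'n::{finite,linorder}" where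
  "diag_row j = sorted_list_of_set (UNIV::'n set) ! rank_of j"

definition first_row :: "'n::{finite,linorder}" where
  "first_row = Min UNIV"

definition stiefel_pos :: "(('n::{finite,linorder},'p::{finite,linorder}) rmat) set" where
  "stiefel_pos = {X \<in> stiefel. \<forall>j. X $ first_row $ j > 0}"

definition Sp :: "('p::{finite,linorder} rvec) set" where
  "Sp = {d. (\<forall>j. 0 < d $ j) \<and> (\<forall>i j. i < j \<longrightarrow> d $ j < d $ i)}"

definition diag_mat :: "'p::{finite,linorder} rvec \<Rightarrow> ('p,'p) rmat" where
  "diag_mat d = (\<chi> i j. if i = j then d $ i else 0)"

text \<open>0F1(n/2, D^2/4) = integral over V_{n,p} of exp(sum_j d_j X_jj) [dX].\<close>
definition F01 :: "(('n::{finite,linorder},'p::{finite,linorder}) rmat) measure \<Rightarrow> 'p rvec \<Rightarrow> real" where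
  "F01 \<mu> d = (\<integral>X. exp (\<Sum>j\<in>UNIV. d $ j * X $ diag_row j $ j) \<partial>\<mu>)"

type_synonym ('n,'p) comp = "('n,'p) rmat \<times> 'p rvec \<times> ('p,'p) rmat"
type_synonym ('c,'n,'p) param = "('c \<Rightarrow> ('n,'p) comp) \<times> ('c \<Rightarrow> real)"

definition f_ML :: "(('n::{finite,linorder},'p::{finite,linorder}) rmat) measure \<Rightarrow>
    ('n,'p) rmat \<Rightarrow> ('n,'p) comp \<Rightarrow> real" where
  "f_ML \<mu> X t = (case t of (M, d, V) \<Rightarrow>
      exp (trace (V ** diag_mat d ** transpose M ** X)) / F01 \<mu> d)"

definition f_mix :: "(('n::{finite,linorder},'p::{finite,linorder}) rmat) measure \<Rightarrow>
    ('n,'p) rmat \<Rightarrow> ('c::{finite,linorder},'n,'p) param \<Rightarrow> real" where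
  "f_mix \<mu> X \<xi> = (\<Sum>c\<in>UNIV. snd \<xi> c * f_ML \<mu> X (fst \<xi> c))"

definition prob_simplex :: "('c::{finite,linorder} \<Rightarrow> real) set" where
  "prob_simplex = {\<pi>. (\<forall>c. 0 < \<pi> c \<and> \<pi> c < 1) \<and> (\<Sum>c\<in>UNIV. \<pi> c) = 1}"

definition Xi :: "('c::{finite,linorder},'n::{finite,linorder},'p::{finite,linorder}) param set" where
  "Xi = {(\<theta>, \<pi>). (\<forall>c. fst (\<theta> c) \<in> stiefel_pos \<and> fst (snd (\<theta> c)) \<in> Sp \<and>
                          snd (snd (\<theta> c)) \<in> stiefel) \<and> \<pi> \<in> prob_simplex}"

definition weak_nbhd :: "(('n::{finite,linorder},'p::{finite,linorder}) rmat) measure \<Rightarrow>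
    ('c::{finite,linorder},'n,'p) param \<Rightarrow> ('c,'n,'p) param set \<Rightarrow> bool" where
  "weak_nbhd \<mu> \<xi>0 U \<longleftrightarrow> U \<subseteq> Xi \<and>
     (\<exists>\<epsilon>>0. \<exists>G. finite G \<and>
        (\<forall>g\<in>G. continuous_on stiefel g \<and> bounded (g ` stiefel)) \<and>
        {\<xi> \<in> Xi. \<forall>g\<in>G. \<bar>(\<integral>X. g X * f_mix \<mu> X \<xi>0 \<partial>\<mu>) - (\<integral>X. g X * f_mix \<mu> X \<xi> \<partial>\<mu>)\<bar> < \<epsilon>}
          \<subseteq> U)"

definition normalized_density :: "'a::type measure \<Rightarrow> ('a \<Rightarrow> real) \<Rightarrow> 'a measure" where
  "normalized_density M h = density M (\<lambda>x. ennreal (h x / (\<integral>y. h y \<partial>M)))"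

definition prior_M :: "(('n::{finite,linorder},'p::{finite,linorder}) rmat) measure \<Rightarrow>
    ('n,'p) rmat \<Rightarrow> (('n,'p) rmat) measure" where
  "prior_M \<mu> G = normalized_density \<mu>
      (\<lambda>M. indicator stiefel_pos M * exp (trace (transpose G ** M)))"

definition prior_V :: "(('p::{finite,linorder},'p) rmat) measure \<Rightarrow> ('p,'p) rmat \<Rightarrow> (('p,'p) rmat) measure" where
  "prior_V \<mu>p H = normalized_density \<mu>p (\<lambda>V. exp (trace (transpose H ** V)))"

definition prior_d :: "(('n::{finite,linorder},'p::{finite,linorder}) rmat) measure \<Rightarrow>
    real \<Rightarrow> 'p rvec \<Rightarrow> ('p rvec) measure" where
  "prior_d \<mu> \<nu> \<eta> = normalized_density lborel
      (\<lambda>d. indicator Sp d * exp (\<nu> * (\<eta> \<bullet> d)) / (F01 \<mu> d) powr \<nu>)"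

text \<open>Dirichlet(alpha): density prod_c pi_c^(alpha_c - 1) on the open simplex with respect
  to Lebesgue measure on the coordinates other than the last one (pi_last = 1 - sum of others).\<close>
definition simplex_ext :: "('c::{finite,linorder} \<Rightarrow> real) \<Rightarrow> ('c \<Rightarrow> real)" where
  "simplex_ext x = (\<lambda>c. if c = Max UNIV then 1 - (\<Sum>c'\<in>UNIV - {Max UNIV}. x c') else x c)"

definition dirichlet :: "('c::{finite,linorder} \<Rightarrow> real) \<Rightarrow> ('c \<Rightarrow> real) measure" where
  "dirichlet \<alpha> = normalized_density
      (distr (PiM (UNIV - {Max UNIV}) (\<lambda>_. lborel)) (PiM UNIV (\<lambda>_. borel)) simplex_ext)
      (\<lambda>\<pi>. indicator prob_simplex \<pi> * (\<Prod>c\<in>UNIV. \<pi> c powr (\<alpha> c - 1)))"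

definition prior ::
  "(('n::{finite,linorder},'p::{finite,linorder}) rmat) measure \<Rightarrow> (('p,'p) rmat) measure \<Rightarrow>
   ('c::{finite,linorder} \<Rightarrow> ('n,'p) rmat) \<Rightarrow> ('c \<Rightarrow> ('p,'p) rmat) \<Rightarrow> ('c \<Rightarrow> real) \<Rightarrow>
   ('c \<Rightarrow> 'p rvec) \<Rightarrow> ('c \<Rightarrow> real) \<Rightarrow> ('c,'n,'p) param measure" where
  "prior \<mu> \<mu>p G H \<nu> \<eta> \<alpha> =
     (PiM UNIV (\<lambda>c. prior_M \<mu> (G c) \<Otimes>\<^sub>M (prior_d \<mu> (\<nu> c) (\<eta> c) \<Otimes>\<^sub>M prior_V \<mu>p (H c))))
     \<Otimes>\<^sub>M dirichlet \<alpha>"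

definition lik_ratio :: "(('n::{finite,linorder},'p::{finite,linorder}) rmat) measure \<Rightarrow>
    ('c::{finite,linorder},'n,'p) param \<Rightarrow> (nat \<Rightarrow> ('n,'p) rmat) \<Rightarrow> nat \<Rightarrow> ('c,'n,'p) param \<Rightarrow> real" where
  "lik_ratio \<mu> \<xi>0 Xs N \<xi> = (\<Prod>i<N. f_mix \<mu> (Xs i) \<xi> / f_mix \<mu> (Xs i) \<xi>0)"

definition posterior :: "('c::{finite,linorder},'n::{finite,linorder},'p::{finite,linorder}) param measure \<Rightarrow>
    (('n,'p) rmat) measure \<Rightarrow> ('c,'n,'p) param \<Rightarrow> (nat \<Rightarrow> ('n,'p) rmat) \<Rightarrow> nat \<Rightarrow>
    ('c,'n,'p) param set \<Rightarrow> real" where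
  "posterior Pr \<mu> \<xi>0 Xs N A =
     (\<integral>\<xi>. indicator A \<xi> * lik_ratio \<mu> \<xi>0 Xs N \<xi> \<partial>Pr) / (\<integral>\<xi>. lik_ratio \<mu> \<xi>0 Xs N \<xi> \<partial>Pr)"

definition true_dist :: "(('n::{finite,linorder},'p::{finite,linorder}) rmat) measure \<Rightarrow>
    ('c::{finite,linorder},'n,'p) param \<Rightarrow> (('n,'p) rmat) measure" where
  "true_dist \<mu> \<xi>0 = density \<mu> (\<lambda>X. ennreal (f_mix \<mu> X \<xi>0))"

end

theory Submission
  imports Defs
begin

text \<open>The orthogonal group acts transitively on the Stiefel manifold (Householder reflections), so all
  balls of a given radius centred on the manifold have the same Haar mass. This makes the left invariant
  probability measure unique, hence right invariant, and positive on open subsets; right invariance is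
  what makes \<open>F01\<close> the normalizing constant of the matrix Langevin density for all \<open>M\<close> and \<open>V\<close>.

  Consistency then follows Schwartz's scheme. The complement of a weak neighbourhood is a finite union
  of sets on which some bounded function \<open>t\<close> has mixture expectation at least \<open>\<epsilon>\<close> above its true one;
  exponential tilting by a small multiple of \<open>t\<close> shows that the integrated likelihood ratio over such a
  set is eventually below \<open>\<rho> ^ N\<close> for some \<open>\<rho> < 1\<close>. The integrated likelihood ratio over the whole
  parameter space is at least \<open>k * r ^ N\<close> for every \<open>r < 1\<close>, because the prior charges the parameters
  whose density is at least \<open>r\<close> times the true one, uniformly on the manifold.

  If some unnormalized prior density is not integrable, \<open>normalized_density\<close> degenerates to the null
  measure and the posterior is \<open>0 / 0 = 0\<close>; this is why no integrability of the prior density of \<open>d\<close>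
  has to be established.\<close>

section \<open>The orthogonal group acting on the Stiefel manifold\<close>

text \<open>Turns the trace exponents of the Langevin densities into Euclidean inner products, to
  which adjoint rules and Cauchy-Schwarz apply.\<close>

lemma inner_matrix_trace:
  fixes X Y :: "real^'p^'n"
  shows "X \<bullet> Y = trace (transpose X ** Y)"
  unfolding trace_def matrix_matrix_mult_def transpose_def inner_vec_def
  by (simp, rule sum.swap)

lemma trace_matrix_mult_comm:
  fixes A :: "real^'p^'n" and B :: "real^'n^'p"
  shows "trace (A ** B) = trace (B ** A)"
  unfolding trace_def matrix_matrix_mult_def by (simp add: mult.commute, rule sum.swap)

lemma inner_matrix_mult_left:
  fixes X Y :: "real^'p^'n" and Q :: "real^'n^'n"
  shows "(Q ** X) \<bullet> Y = X \<bullet> (transpose Q ** Y)"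
  by (simp add: inner_matrix_trace matrix_transpose_mul matrix_mul_assoc)

lemma inner_matrix_mult_right:
  fixes X Y :: "real^'p^'n" and V :: "real^'p^'p"
  shows "(X ** V) \<bullet> Y = X \<bullet> (Y ** transpose V)"
proof -
  have "(X ** V) \<bullet> Y = trace (transpose V ** (transpose X ** Y))"
    by (simp add: inner_matrix_trace matrix_transpose_mul matrix_mul_assoc)
  also have "\<dots> = trace ((transpose X ** Y) ** transpose V)"
    by (rule trace_matrix_mult_comm)
  finally show ?thesis
    by (simp add: inner_matrix_trace matrix_mul_assoc)
qed

lemma inner_orthogonal_mult:
  fixes X Y :: "real^'p^'n"
  assumes "orthogonal_matrix Q"
  shows "(Q ** X) \<bullet> (Q ** Y) = X \<bullet> Y"
  using assms by (simp add: inner_matrix_mult_left orthogonal_matrix matrix_mul_assoc)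

lemma dist_orthogonal_mult:
  fixes X Y :: "real^'p^'n"
  assumes "orthogonal_matrix Q"
  shows "dist (Q ** X) (Q ** Y) = dist X Y"
proof -
  have "Q ** X - Q ** Y = Q ** (X - Y)"
    by (simp add: matrix_matrix_mult_def vec_eq_iff algebra_simps sum_subtractf)
  then show ?thesis
    using inner_orthogonal_mult[OF assms, of "X - Y" "X - Y"]
    by (simp add: dist_norm norm_eq_sqrt_inner)
qed

lemma continuous_matrix_mult [continuous_intros]:
  fixes f :: "'a::topological_space \<Rightarrow> real^'p^'n" and g :: "'a \<Rightarrow> real^'m^'p"
  assumes "continuous_on S f" "continuous_on S g"
  shows "continuous_on S (\<lambda>x. f x ** g x)"
  unfolding matrix_matrix_mult_def using assms by (intro continuous_intros)

lemma continuous_transpose [continuous_intros]: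
  fixes f :: "'a::topological_space \<Rightarrow> real^'p^'n"
  assumes "continuous_on S f"
  shows "continuous_on S (\<lambda>x. transpose (f x))"
  unfolding transpose_def using assms by (intro continuous_intros)

text \<open>The p columns are unit vectors. The resulting bound sqrt p gives compactness and makes
  every later estimate of exponents uniform in \<open>X\<close>.\<close>

lemma norm_stiefel:
  fixes X :: "('n::{finite,linorder},'p::{finite,linorder}) rmat"
  assumes "X \<in> stiefel"
  shows "norm X = sqrt CARD('p)"
proof -
  have "X \<bullet> X = CARD('p)"
    using assms by (simp add: stiefel_def inner_matrix_trace trace_def mat_def)
  then show ?thesis
    by (simp add: norm_eq_sqrt_inner)
qed

lemma closed_stiefel: "closed (stiefel :: ('n::{finite,linorder},'p::{finite,linorder}) rmat set)"
  unfolding stiefel_def by (intro closed_Collect_eq continuous_intros)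

lemma compact_stiefel: "compact (stiefel :: ('n::{finite,linorder},'p::{finite,linorder}) rmat set)"
  using closed_stiefel by (auto simp: compact_eq_bounded_closed bounded_iff norm_stiefel)

lemma stiefel_mult_right:
  assumes "orthogonal_matrix V" "X \<in> stiefel"
  shows "X ** V \<in> stiefel"
proof -
  have "transpose (X ** V) ** (X ** V) = transpose V ** (transpose X ** X) ** V"
    by (simp add: matrix_transpose_mul matrix_mul_assoc)
  then show ?thesis
    using assms by (simp add: stiefel_def orthogonal_matrix)
qed

text \<open>\<open>Q\<close> is the reflection in the hyperplane orthogonal to \<open>u - v\<close>.
  That it fixes this hyperplane pointwise is what lets columns be matched one at a time.\<close>

lemma householder:
  fixes u v :: "real^'n"
  assumes "norm u = norm v"
  obtains Q where "orthogonal_matrix Q" "Q *v u = v" "\<And>w. w \<bullet> (u - v) = 0 \<Longrightarrow> Q *v w = w"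
proof -
  define a where "a = u - v"
  \<comment> \<open>For \<open>u = v\<close> the quotient is 0/0 = 0 and \<open>f\<close> is the
    identity, so this case needs no separate definition.\<close>
  define f where "f w = w - (2 * (w \<bullet> a) / (a \<bullet> a)) *\<^sub>R a" for w :: "real^'n"
  have lin: "linear f"
    unfolding f_def by (rule linearI) (auto simp: algebra_simps add_divide_distrib inner_add_left)
  have "f w \<bullet> f z = w \<bullet> z" for w z
    by (cases "a = 0") (simp_all add: f_def inner_diff_left inner_diff_right field_simps inner_commute)
  then have "orthogonal_transformation f"
    using lin by (simp add: orthogonal_transformation_def)
  then have orth: "orthogonal_matrix (matrix f)"
    by (simp add: orthogonal_transformation_matrix)
  have app: "matrix f *v w = f w" for w
    using lin by (simp add: matrix_works)
  \<comment> \<open>Equality of the norms enters here: it makes the coefficient of \<open>a\<close>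
    in \<open>f u\<close> equal to 1.\<close>
  have "2 * (u \<bullet> a) = a \<bullet> a"
    using assms by (simp add: a_def inner_diff_left inner_diff_right norm_eq inner_commute)
  then have "f u = v"
    by (cases "a = 0") (auto simp: f_def a_def)
  then show thesis
    using that[of "matrix f"] orth app by (auto simp: f_def a_def)
qed

lemma inner_column_stiefel:
  assumes "X \<in> stiefel"
  shows "column i X \<bullet> column j X = (if i = j then 1 else 0)"
proof -
  have "column i X \<bullet> column j X = (transpose X ** X) $ i $ j"
    by (simp add: column_def inner_vec_def matrix_matrix_mult_def transpose_def)
  then show ?thesis
    using assms by (simp add: stiefel_def mat_def)
qed

text \<open>Induction on the set of matched columns. The reflection sending
  \<open>Q *v column k X\<close> to \<open>column k Y\<close> leaves each matched
  \<open>column j Y\<close> alone: that column is orthogonal to both vectors, since \<open>Q\<close>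
  preserves inner products and the columns of \<open>X\<close> and of \<open>Y\<close> are
  orthonormal.\<close>

lemma orthogonal_transitive_columns:
  fixes X Y :: "('n::{finite,linorder},'p::{finite,linorder}) rmat"
  assumes X: "X \<in> stiefel" and Y: "Y \<in> stiefel" and "finite A"
  shows "\<exists>Q. orthogonal_matrix Q \<and> (\<forall>j\<in>A. Q *v column j X = column j Y)"
  using \<open>finite A\<close>
proof (induction A)
  case empty
  show ?case
    using orthogonal_matrix_id by blast
next
  case (insert k A)
  then obtain Q where Q: "orthogonal_matrix Q" "\<And>j. j \<in> A \<Longrightarrow> Q *v column j X = column j Y"
    by blast
  have inn: "(Q *v x) \<bullet> (Q *v y) = x \<bullet> y" for x y
    using Q(1) orthogonal_transformation_matrix[of "(*v) Q"] by (simp add: orthogonal_transformation_def)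
  have "norm (Q *v column k X) = norm (column k Y)"
    using inner_column_stiefel[OF X] inner_column_stiefel[OF Y] by (simp add: norm_eq_sqrt_inner inn)
  then obtain R where R: "orthogonal_matrix R" "R *v (Q *v column k X) = column k Y"
      "\<And>w. w \<bullet> (Q *v column k X - column k Y) = 0 \<Longrightarrow> R *v w = w"
    using householder by metis
  have "R *v (Q *v column j X) = column j Y" if "j \<in> A" for j
  proof -
    have "j \<noteq> k" using that insert by auto
    have "column j Y \<bullet> (Q *v column k X - column k Y) = column j X \<bullet> column k X - column j Y \<bullet> column k Y"
      by (simp add: inner_diff_right inn flip: Q(2)[OF that])
    also have "\<dots> = 0"
      using \<open>j \<noteq> k\<close> by (simp add: inner_column_stiefel X Y)
    finally show ?thesis
      using R(3) Q(2)[OF that] by simp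
  qed
  then have "\<forall>j\<in>insert k A. (R ** Q) *v column j X = column j Y"
    using R(2) by (simp flip: matrix_vector_mul_assoc)
  then show ?case
    using orthogonal_matrix_mul[OF R(1) Q(1)] by blast
qed

lemma orthogonal_transitive_stiefel:
  fixes X Y :: "('n::{finite,linorder},'p::{finite,linorder}) rmat"
  assumes "X \<in> stiefel" "Y \<in> stiefel"
  obtains Q where "orthogonal_matrix Q" "Q ** X = Y"
proof -
  obtain Q where Q: "orthogonal_matrix Q" "\<And>j. Q *v column j X = column j Y"
    using orthogonal_transitive_columns[OF assms, of UNIV] by auto
  have "(Q ** X) $ i $ j = Y $ i $ j" for i j
    using arg_cong[OF Q(2), of "\<lambda>v. v $ i" j]
    by (simp add: matrix_vector_mult_def matrix_matrix_mult_def column_def)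
  then show thesis
    using that Q(1) by (simp add: vec_eq_iff)
qed

text \<open>The rectangular identity matrix, with ones at the positions called X_jj in
  \<open>F01\<close>. It is the base point of the manifold from which all other points are reached
  by orthogonal matrices.\<close>

definition diag_embed :: "('n::{finite,linorder},'p::{finite,linorder}) rmat" where
  "diag_embed = (\<chi> i j. if i = diag_row j then 1 else 0)"

section \<open>Ranks and diagonal positions\<close>

lemma rank_of_less: "rank_of (j::'a::{finite,linorder}) < CARD('a)"
  unfolding rank_of_def by (rule psubset_card_mono) auto

lemma rank_of_strict_mono: "i < j \<Longrightarrow> rank_of i < rank_of j"
  unfolding rank_of_def by (rule psubset_card_mono) auto

lemma rank_of_eq_iff: "rank_of i = rank_of j \<longleftrightarrow> i = j"
  by (metis less_irrefl linorder_neqE rank_of_strict_mono)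

text \<open>With at least as many rows as columns, every column rank is a valid index into the
  sorted list of rows, and lookup in a list without duplicates is injective.\<close>

lemma diag_row_eq_iff:
  assumes "CARD('p::{finite,linorder}) \<le> CARD('n::{finite,linorder})"
  shows "(diag_row (i::'p) :: 'n) = diag_row j \<longleftrightarrow> i = j"
proof -
  have "rank_of i < CARD('n)" "rank_of j < CARD('n)"
    using assms rank_of_less[of i] rank_of_less[of j] by auto
  then show ?thesis
    by (simp add: diag_row_def nth_eq_iff_index_eq rank_of_eq_iff)
qed

lemma diag_embed_stiefel:
  assumes "CARD('p::{finite,linorder}) \<le> CARD('n::{finite,linorder})"
  shows "(diag_embed :: ('n,'p) rmat) \<in> stiefel"
  using diag_row_eq_iff[OF assms]
  by (auto simp: stiefel_def diag_embed_def matrix_matrix_mult_def transpose_def mat_def vec_eq_iff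
      if_distrib[of "\<lambda>x. x * _"] cong: if_cong)

section \<open>Uniqueness and invariance of the Haar measure\<close>

lemma haar_stiefel_sets: "haar_stiefel \<mu> \<Longrightarrow> sets \<mu> = sets borel"
  by (simp add: haar_stiefel_def)

lemma haar_stiefel_space: "haar_stiefel \<mu> \<Longrightarrow> space \<mu> = UNIV"
  by (metis haar_stiefel_sets sets_eq_imp_space_eq space_borel)

lemma haar_stiefel_prob: "haar_stiefel \<mu> \<Longrightarrow> prob_space \<mu>"
  by (simp add: haar_stiefel_def)

lemma borel_stiefel [measurable]: "stiefel \<in> sets borel"
  by (rule borel_closed[OF closed_stiefel])

lemma haar_stiefel_AE:
  assumes "haar_stiefel \<mu>"
  shows "AE X in \<mu>. X \<in> stiefel"
proof -
  interpret prob_space \<mu> by (rule haar_stiefel_prob[OF assms])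
  have "prob stiefel = 1"
    using assms by (simp add: haar_stiefel_def measure_def)
  then show ?thesis
    using haar_stiefel_sets[OF assms] borel_stiefel by (subst (asm) prob_eq_1) auto
qed

lemma borel_measurable_matrix_mult_left [measurable]:
  "(\<lambda>X. Q ** X :: real^'p^'n) \<in> borel_measurable borel"
  by (intro borel_measurable_continuous_onI continuous_intros)

lemma borel_measurable_matrix_mult_right [measurable]:
  "(\<lambda>X. X ** V :: real^'p^'n) \<in> borel_measurable borel"
  by (intro borel_measurable_continuous_onI continuous_intros)

text \<open>An orthogonal \<open>Q\<close> with \<open>Q ** X = Y\<close> acts isometrically, so the
  preimage of a ball about \<open>Y\<close> is the ball of the same radius about
  \<open>X\<close>.\<close>

lemma haar_stiefel_measure_ball_eq:
  assumes \<mu>: "haar_stiefel \<mu>" and "X \<in> stiefel" "Y \<in> stiefel"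
  shows "measure \<mu> (ball X r) = measure \<mu> (ball Y r)"
proof -
  obtain Q where Q: "orthogonal_matrix Q" "Q ** X = Y"
    using orthogonal_transitive_stiefel assms by metis
  have "measure \<mu> (ball Y r) = measure (distr \<mu> borel (\<lambda>X. Q ** X)) (ball Y r)"
    using \<mu> Q by (simp add: haar_stiefel_def)
  also have "\<dots> = measure \<mu> ((\<lambda>X. Q ** X) -` ball Y r \<inter> space \<mu>)"
    using haar_stiefel_sets[OF \<mu>] by (intro measure_distr) (simp_all cong: measurable_cong_sets)
  also have "(\<lambda>X. Q ** X) -` ball Y r \<inter> space \<mu> = ball X r"
    using dist_orthogonal_mult[OF Q(1), of X] by (auto simp: haar_stiefel_space[OF \<mu>] Q(2))
  finally show ?thesis ..
qed

text \<open>If one ball were null, all balls of that radius centred on the manifold would be;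
  finitely many of them cover the compact manifold, which has mass one.\<close>

lemma haar_stiefel_measure_ball_pos:
  fixes \<mu> :: "('n::{finite,linorder},'p::{finite,linorder}) rmat measure"
  assumes \<mu>: "haar_stiefel \<mu>" and X: "X \<in> stiefel" and "0 < r"
  shows "0 < measure \<mu> (ball X r)"
proof (rule ccontr)
  interpret prob_space \<mu> by (rule haar_stiefel_prob[OF \<mu>])
  assume "\<not> 0 < measure \<mu> (ball X r)"
  then have null: "measure \<mu> (ball Y r) = 0" if "Y \<in> stiefel" for Y
    using haar_stiefel_measure_ball_eq[OF \<mu> X that, of r] measure_nonneg[of \<mu> "ball X r"] by linarith
  obtain T where T: "finite T" "T \<subseteq> stiefel" "(stiefel :: ('n,'p) rmat set) \<subseteq> (\<Union>Y\<in>T. ball Y r)"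
    by (rule compactE_image[OF compact_stiefel, of stiefel "\<lambda>Y. ball Y r"]) (use \<open>0 < r\<close> in auto)
  have "prob stiefel \<le> prob (\<Union>Y\<in>T. ball Y r)"
    using T haar_stiefel_sets[OF \<mu>] by (intro finite_measure_mono) auto
  also have "\<dots> \<le> (\<Sum>Y\<in>T. prob (ball Y r))"
    using T haar_stiefel_sets[OF \<mu>] by (intro finite_measure_subadditive_finite) auto
  also have "\<dots> = 0"
    using T null by (intro sum.neutral) auto
  finally show False
    using \<mu> by (simp add: haar_stiefel_def measure_def)
qed

text \<open>Integrating out the \<open>\<mu>'\<close> variable leaves the mass of a ball about
  \<open>X\<close>, which does not depend on \<open>X\<close> on the manifold and factors out. Both
  orders of the product are given so that, after exchanging the roles of the measures, integrals of
  \<open>f (fst z)\<close> and \<open>f (snd z)\<close> can be compared over one product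
  measure.\<close>

lemma integral_near_diagonal:
  fixes \<mu> \<mu>' :: "('n::{finite,linorder},'p::{finite,linorder}) rmat measure"
  assumes \<mu>: "haar_stiefel \<mu>" and \<mu>': "haar_stiefel \<mu>'"
    and f: "f \<in> borel_measurable borel" "\<And>X. \<bar>f X\<bar> \<le> B" and Y: "Y \<in> stiefel"
  shows "integrable (\<mu> \<Otimes>\<^sub>M \<mu>') (\<lambda>z. indicator {z. dist (fst z) (snd z) < r} z * f (fst z))"
        (is "integrable _ ?F")
    and "(\<integral>z. indicator {z. dist (fst z) (snd z) < r} z * f (fst z) \<partial>(\<mu> \<Otimes>\<^sub>M \<mu>'))
      = measure \<mu>' (ball Y r) * (\<integral>X. f X \<partial>\<mu>)"
    and "integrable (\<mu>' \<Otimes>\<^sub>M \<mu>) (\<lambda>z. indicator {z. dist (fst z) (snd z) < r} z * f (snd z))"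
        (is "integrable _ ?G")
    and "(\<integral>z. indicator {z. dist (fst z) (snd z) < r} z * f (snd z) \<partial>(\<mu>' \<Otimes>\<^sub>M \<mu>))
      = measure \<mu>' (ball Y r) * (\<integral>X. f X \<partial>\<mu>)"
proof -
  interpret p: prob_space \<mu> by (rule haar_stiefel_prob[OF \<mu>])
  interpret p': prob_space \<mu>' by (rule haar_stiefel_prob[OF \<mu>'])
  interpret pp: pair_prob_space \<mu> \<mu>' by unfold_locales
  interpret pp': pair_prob_space \<mu>' \<mu> by unfold_locales
  note [measurable_cong] = haar_stiefel_sets[OF \<mu>] haar_stiefel_sets[OF \<mu>']
  note f(1)[measurable]
  have B: "\<bar>indicator A z * f x\<bar> \<le> B" for A x and z :: "('n,'p) rmat \<times> ('n,'p) rmat"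
    using f(2)[of x] by (auto simp: indicator_def)
  show int: "integrable (\<mu> \<Otimes>\<^sub>M \<mu>') ?F"
    by (rule pp.integrable_const_bound[where B=B], rule AE_I2, simp only: real_norm_def B, measurable)
  show int': "integrable (\<mu>' \<Otimes>\<^sub>M \<mu>) ?G"
    by (rule pp'.integrable_const_bound[where B=B], rule AE_I2, simp only: real_norm_def B, measurable)
  have inner: "(\<integral>Z. indicator (ball X r) Z * f X \<partial>\<mu>') = measure \<mu>' (ball Y r) * f X"
    if "X \<in> stiefel" for X
    using that haar_stiefel_measure_ball_eq[OF \<mu>' that Y]
    by (simp add: haar_stiefel_sets[OF \<mu>'])
  have eq: "indicator {z. dist (fst z) (snd z) < r} (X, Z) = (indicator (ball X r) Z :: real)"
    "indicator {z. dist (fst z) (snd z) < r} (Z, X) = (indicator (ball X r) Z :: real)"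
    for X Z :: "('n,'p) rmat"
    by (auto simp: indicator_def dist_commute)
  have "(\<integral>z. ?F z \<partial>(\<mu> \<Otimes>\<^sub>M \<mu>')) = (\<integral>X. (\<integral>Z. ?F (X, Z) \<partial>\<mu>') \<partial>\<mu>)"
    by (rule pp.integral_fst'[OF int, symmetric])
  also have "\<dots> = (\<integral>X. measure \<mu>' (ball Y r) * f X \<partial>\<mu>)"
  proof (rule integral_cong_AE)
    show "AE X in \<mu>. (\<integral>Z. ?F (X, Z) \<partial>\<mu>') = measure \<mu>' (ball Y r) * f X"
      using haar_stiefel_AE[OF \<mu>] by eventually_elim (simp only: eq(1) inner fst_conv snd_conv)
  qed measurable
  finally show "(\<integral>z. ?F z \<partial>(\<mu> \<Otimes>\<^sub>M \<mu>')) = measure \<mu>' (ball Y r) * (\<integral>X. f X \<partial>\<mu>)"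
    by simp
  have "(\<integral>z. ?G z \<partial>(\<mu>' \<Otimes>\<^sub>M \<mu>)) = (\<integral>X. (\<integral>Z. ?G (Z, X) \<partial>\<mu>') \<partial>\<mu>)"
    using pp'.integral_snd[of "\<lambda>x y. ?G (x, y)"] int' by (simp add: case_prod_beta')
  also have "\<dots> = (\<integral>X. measure \<mu>' (ball Y r) * f X \<partial>\<mu>)"
  proof (rule integral_cong_AE)
    show "AE X in \<mu>. (\<integral>Z. ?G (Z, X) \<partial>\<mu>') = measure \<mu>' (ball Y r) * f X"
      using haar_stiefel_AE[OF \<mu>] by eventually_elim (simp only: eq(2) inner fst_conv snd_conv)
  qed measurable
  finally show "(\<integral>z. ?G z \<partial>(\<mu>' \<Otimes>\<^sub>M \<mu>)) = measure \<mu>' (ball Y r) * (\<integral>X. f X \<partial>\<mu>)"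
    by simp
qed

text \<open>Both measures give all balls of a fixed radius centred on the manifold the same mass, so
  integrating over \<open>\<mu> \<Otimes> \<mu>'\<close> restricted to \<open>dist X Y < r\<close> yields multiples of
  both integrals, which differ by the oscillation of \<open>f\<close> at scale \<open>r\<close>; there is no need for an
  invariant measure on the orthogonal group itself.\<close>

lemma haar_stiefel_integral_unique:
  fixes f :: "('n::{finite,linorder},'p::{finite,linorder}) rmat \<Rightarrow> real"
  assumes \<mu>: "haar_stiefel \<mu>" and \<mu>': "haar_stiefel \<mu>'"
    and f: "continuous_on stiefel f" "f \<in> borel_measurable borel"
  shows "(\<integral>X. f X \<partial>\<mu>) = (\<integral>X. f X \<partial>\<mu>')"
proof -
  interpret p: prob_space \<mu> by (rule haar_stiefel_prob[OF \<mu>])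
  interpret p': prob_space \<mu>' by (rule haar_stiefel_prob[OF \<mu>'])
  interpret pp: pair_prob_space \<mu> \<mu>' by unfold_locales
  note [measurable_cong] = haar_stiefel_sets[OF \<mu>] haar_stiefel_sets[OF \<mu>']
  note f(2)[measurable]
  have ne: "stiefel \<noteq> ({} :: ('n,'p) rmat set)"
    using \<mu> by (auto simp: haar_stiefel_def)
  then obtain Y where Y: "Y \<in> (stiefel :: ('n,'p) rmat set)"
    by blast
  \<comment> \<open>Cutting \<open>f\<close> off outside the manifold makes it globally bounded and
    changes neither integral.\<close>
  define g where "g X = indicator stiefel X * f X" for X
  have g_meas [measurable]: "g \<in> borel_measurable borel"
    unfolding g_def by measurable
  obtain B where B: "\<And>X. X \<in> stiefel \<Longrightarrow> \<bar>f X\<bar> \<le> B"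
    using compact_imp_bounded[OF compact_continuous_image[OF f(1) compact_stiefel]]
    by (auto simp: bounded_iff)
  have "0 \<le> B"
    using B[OF Y] by simp
  then have gB: "\<bar>g X\<bar> \<le> B" for X
    using B by (auto simp: g_def indicator_def)
  have fg: "(\<integral>X. f X \<partial>\<mu>) = (\<integral>X. g X \<partial>\<mu>)" "(\<integral>X. f X \<partial>\<mu>') = (\<integral>X. g X \<partial>\<mu>')"
    using haar_stiefel_AE[OF \<mu>] haar_stiefel_AE[OF \<mu>']
    by (auto intro!: integral_cong_AE simp: g_def elim!: eventually_mono)
  have "\<bar>(\<integral>X. g X \<partial>\<mu>) - (\<integral>X. g X \<partial>\<mu>')\<bar> \<le> e" if "0 < e" for e
  proof -
    obtain r where r: "0 < r" "\<And>X Z. X \<in> stiefel \<Longrightarrow> Z \<in> stiefel \<Longrightarrow> dist X Z < r \<Longrightarrow> \<bar>f X - f Z\<bar> < e"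
      using compact_uniformly_continuous[OF f(1) compact_stiefel] \<open>0 < e\<close>
      by (auto simp: uniformly_continuous_on_def dist_real_def abs_minus_commute) (metis dist_commute)
    let ?K = "\<lambda>z :: ('n,'p) rmat \<times> ('n,'p) rmat. indicator {z. dist (fst z) (snd z) < r} z :: real"
    let ?P = "\<mu> \<Otimes>\<^sub>M \<mu>'"
    define h where "h = measure \<mu>' (ball Y r)"
    have "h > 0"
      unfolding h_def by (rule haar_stiefel_measure_ball_pos[OF \<mu>' Y r(1)])
    \<comment> \<open>The constant function 1, used with the roles of the two measures exchanged,
      computes the mass of the kernel in two ways; hence both measures give balls of radius
      \<open>r\<close> the same mass \<open>h\<close>.\<close>
    have K: "integrable ?P ?K" "(\<integral>z. ?K z \<partial>?P) = h" "(\<integral>z. ?K z \<partial>?P) = measure \<mu> (ball Y r)"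
      using integral_near_diagonal[OF \<mu> \<mu>' _ _ Y, of "\<lambda>_. 1" 1 r]
        integral_near_diagonal[OF \<mu>' \<mu> _ _ Y, of "\<lambda>_. 1" 1 r]
      by (simp_all add: h_def p.prob_space p'.prob_space)
    have 1: "integrable ?P (\<lambda>z. ?K z * g (fst z))" "(\<integral>z. ?K z * g (fst z) \<partial>?P) = h * (\<integral>X. g X \<partial>\<mu>)"
      using integral_near_diagonal(1,2)[OF \<mu> \<mu>' g_meas gB Y] by (simp_all add: h_def)
    have 2: "integrable ?P (\<lambda>z. ?K z * g (snd z))" "(\<integral>z. ?K z * g (snd z) \<partial>?P) = h * (\<integral>X. g X \<partial>\<mu>')"
      using integral_near_diagonal(3,4)[OF \<mu>' \<mu> g_meas gB Y] K(2,3) by simp_all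
    \<comment> \<open>Where the kernel is nonzero, the two almost surely manifold-valued arguments
      are within \<open>r\<close> and \<open>f\<close> varies by less than \<open>e\<close>;
      elsewhere both sides vanish.\<close>
    have ae: "AE z in ?P. \<bar>?K z * g (fst z) - ?K z * g (snd z)\<bar> \<le> e * ?K z"
    proof -
      have "AE z in ?P. fst z \<in> stiefel" "AE z in ?P. snd z \<in> stiefel"
        using haar_stiefel_AE[OF \<mu>] haar_stiefel_AE[OF \<mu>']
        by (auto intro!: pp.AE_pair_measure)
      then show ?thesis
      proof eventually_elim
        case (elim z)
        then show ?case
          using r(2)[of "fst z" "snd z"] by (auto simp: g_def indicator_def)
      qed
    qed
    have "h * \<bar>(\<integral>X. g X \<partial>\<mu>) - (\<integral>X. g X \<partial>\<mu>')\<bar> = \<bar>h * (\<integral>X. g X \<partial>\<mu>) - h * (\<integral>X. g X \<partial>\<mu>')\<bar>"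
      using \<open>h > 0\<close> by (simp add: abs_mult flip: right_diff_distrib)
    also have "\<dots> = \<bar>\<integral>z. ?K z * g (fst z) - ?K z * g (snd z) \<partial>?P\<bar>"
      using 1 2 by simp
    also have "\<dots> \<le> (\<integral>z. \<bar>?K z * g (fst z) - ?K z * g (snd z)\<bar> \<partial>?P)"
      by (rule integral_abs_bound)
    also have "\<dots> \<le> (\<integral>z. e * ?K z \<partial>?P)"
      using 1 2 K ae by (intro integral_mono_AE) auto
    also have "\<dots> = h * e"
      using K by simp
    finally show ?thesis
      using \<open>h > 0\<close> by simp
  qed
  then show ?thesis
    unfolding fg using field_le_epsilon[of "\<bar>(\<integral>X. g X \<partial>\<mu>) - (\<integral>X. g X \<partial>\<mu>')\<bar>" 0] by simp
qed

text \<open>Left and right multiplication commute, so the image measure inherits left invariance.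
  Uniqueness then identifies its integrals with those of \<open>\<mu>\<close>.\<close>

lemma haar_stiefel_distr_right:
  fixes \<mu> :: "('n::{finite,linorder},'p::{finite,linorder}) rmat measure"
  assumes \<mu>: "haar_stiefel \<mu>" and V: "orthogonal_matrix V"
  shows "haar_stiefel (distr \<mu> borel (\<lambda>X. X ** V))"
proof -
  interpret prob_space \<mu> by (rule haar_stiefel_prob[OF \<mu>])
  note [measurable_cong] = haar_stiefel_sets[OF \<mu>]
  let ?\<nu> = "distr \<mu> borel (\<lambda>X. X ** V)"
  have ps: "prob_space ?\<nu>"
    by (rule prob_space_distr) simp
  interpret \<nu>: prob_space ?\<nu> by fact
  have "AE X in ?\<nu>. X \<in> stiefel"
    using haar_stiefel_AE[OF \<mu>]
    by (subst AE_distr_iff) (auto elim!: eventually_mono intro: stiefel_mult_right[OF V])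
  then have "emeasure ?\<nu> stiefel = 1"
    using \<nu>.prob_eq_1[of stiefel] by (simp add: \<nu>.emeasure_eq_measure)
  moreover have "distr ?\<nu> borel (\<lambda>X. Q ** X) = ?\<nu>" if "orthogonal_matrix Q" for Q :: "('n,'n) rmat"
  proof -
    have "distr ?\<nu> borel (\<lambda>X. Q ** X) = distr (distr \<mu> borel (\<lambda>X. Q ** X)) borel (\<lambda>X. X ** V)"
      by (simp add: distr_distr comp_def matrix_mul_assoc)
    then show ?thesis
      using \<mu> that by (simp add: haar_stiefel_def)
  qed
  ultimately show ?thesis
    using ps by (simp add: haar_stiefel_def)
qed

text \<open>The Laplace transform of Haar measure at a matrix argument. Its invariance on both sides
  explains why the normalizing constant involves only the singular values \<open>d\<close>.\<close>

definition stiefel_lap :: "('n::{finite,linorder},'p::{finite,linorder}) rmat measure \<Rightarrow> ('n,'p) rmat \<Rightarrow> real"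
  where "stiefel_lap \<mu> A = (\<integral>X. exp (A \<bullet> X) \<partial>\<mu>)"

lemma stiefel_lap_mult_left:
  assumes \<mu>: "haar_stiefel \<mu>" and Q: "orthogonal_matrix Q"
  shows "stiefel_lap \<mu> (Q ** A) = stiefel_lap \<mu> A"
proof -
  note [measurable_cong] = haar_stiefel_sets[OF \<mu>]
  have "stiefel_lap \<mu> (Q ** A) = (\<integral>X. exp ((Q ** A) \<bullet> X) \<partial>distr \<mu> borel (\<lambda>X. Q ** X))"
    using \<mu> Q by (simp add: haar_stiefel_def stiefel_lap_def)
  also have "\<dots> = (\<integral>X. exp ((Q ** A) \<bullet> (Q ** X)) \<partial>\<mu>)"
    by (rule integral_distr) simp_all
  finally show ?thesis
    by (simp add: inner_orthogonal_mult[OF Q] stiefel_lap_def)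
qed

text \<open>\<open>V\<close> is moved across the inner product onto \<open>X\<close>; the image of
  \<open>\<mu>\<close> under that right multiplication is again Haar, and the exponential is
  continuous.\<close>

lemma stiefel_lap_mult_right:
  assumes \<mu>: "haar_stiefel \<mu>" and V: "orthogonal_matrix V"
  shows "stiefel_lap \<mu> (A ** V) = stiefel_lap \<mu> A"
proof -
  note [measurable_cong] = haar_stiefel_sets[OF \<mu>]
  have V': "orthogonal_matrix (transpose V)"
    using V by (simp add: orthogonal_matrix_transpose)
  have "stiefel_lap \<mu> (A ** V) = (\<integral>X. exp (A \<bullet> (X ** transpose V)) \<partial>\<mu>)"
    by (simp add: inner_matrix_mult_right stiefel_lap_def)
  also have "\<dots> = (\<integral>X. exp (A \<bullet> X) \<partial>distr \<mu> borel (\<lambda>X. X ** transpose V))"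
    by (rule integral_distr[symmetric]) simp_all
  also have "\<dots> = stiefel_lap \<mu> A"
    unfolding stiefel_lap_def
    by (intro haar_stiefel_integral_unique haar_stiefel_distr_right \<mu> V' continuous_intros) simp_all
  finally show ?thesis .
qed

section \<open>Matrix Langevin densities\<close>

lemma transpose_diag_mat: "transpose (diag_mat d) = diag_mat d"
  by (auto simp: transpose_def diag_mat_def vec_eq_iff)

lemma diag_embed_mult_diag_mat:
  "diag_embed ** diag_mat d = (\<chi> i j. if i = diag_row j then d $ j else 0)"
  by (simp add: diag_embed_def diag_mat_def matrix_matrix_mult_def vec_eq_iff
      if_distrib[of "\<lambda>x. _ * x"] cong: if_cong)

lemma F01_eq_stiefel_lap:
  fixes \<mu> :: "('n::{finite,linorder},'p::{finite,linorder}) rmat measure"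
  shows "F01 \<mu> d = stiefel_lap \<mu> (diag_embed ** diag_mat d)"
proof -
  have "(diag_embed ** diag_mat d) \<bullet> X = (\<Sum>j\<in>UNIV. d $ j * X $ diag_row j $ j)" for X :: "('n,'p) rmat"
  proof -
    have "(diag_embed ** diag_mat d) \<bullet> X
        = (\<Sum>j\<in>UNIV. \<Sum>i\<in>UNIV. (if i = diag_row j then d $ j else 0) * X $ i $ j)"
      unfolding diag_embed_mult_diag_mat inner_vec_def by (simp, rule sum.swap)
    then show ?thesis
      by (simp add: if_distrib[of "\<lambda>x. x * _"] cong: if_cong)
  qed
  then show ?thesis
    by (simp add: F01_def stiefel_lap_def)
qed

text \<open>The natural parameter of the exponential family, given through a singular value
  decomposition.\<close>

fun langevin_par :: "('n::{finite,linorder},'p::{finite,linorder}) comp \<Rightarrow> ('n,'p) rmat" where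
  "langevin_par (M, d, V) = M ** diag_mat d ** transpose V"

lemma f_ML_eq: "f_ML \<mu> X t = exp (langevin_par t \<bullet> X) / F01 \<mu> (fst (snd t))"
  by (cases t) (simp add: f_ML_def inner_matrix_trace matrix_transpose_mul transpose_diag_mat matrix_mul_assoc)

lemma inner_le_stiefel:
  fixes A X :: "('n::{finite,linorder},'p::{finite,linorder}) rmat"
  assumes "X \<in> stiefel"
  shows "\<bar>A \<bullet> X\<bar> \<le> norm A * sqrt CARD('p)"
  using Cauchy_Schwarz_ineq2[of A X] norm_stiefel[OF assms] by simp

lemma integrable_exp_inner:
  fixes A :: "('n::{finite,linorder},'p::{finite,linorder}) rmat"
  assumes \<mu>: "haar_stiefel \<mu>"
  shows "integrable \<mu> (\<lambda>X. exp (A \<bullet> X))"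
proof -
  interpret prob_space \<mu> by (rule haar_stiefel_prob[OF \<mu>])
  note [measurable_cong] = haar_stiefel_sets[OF \<mu>]
  have "AE X in \<mu>. norm (exp (A \<bullet> X)) \<le> exp (norm A * sqrt CARD('p))"
    using haar_stiefel_AE[OF \<mu>]
    by eventually_elim (drule inner_le_stiefel[of _ A], simp add: abs_le_iff)
  then show ?thesis
    by (rule integrable_const_bound) measurable
qed

lemma stiefel_lap_pos:
  fixes A :: "('n::{finite,linorder},'p::{finite,linorder}) rmat"
  assumes \<mu>: "haar_stiefel \<mu>"
  shows "0 < stiefel_lap \<mu> A"
proof -
  interpret prob_space \<mu> by (rule haar_stiefel_prob[OF \<mu>])
  have "AE X in \<mu>. exp (- (norm A * sqrt CARD('p))) \<le> exp (A \<bullet> X)"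
    using haar_stiefel_AE[OF \<mu>] by eventually_elim (drule inner_le_stiefel[of _ A], simp add: abs_le_iff)
  then have "exp (- (norm A * sqrt CARD('p))) \<le> stiefel_lap \<mu> A"
    unfolding stiefel_lap_def by (rule integral_ge_const[OF integrable_exp_inner[OF \<mu>]])
  then show ?thesis
    by (rule less_le_trans[OF exp_gt_zero])
qed

lemma F01_pos: "haar_stiefel \<mu> \<Longrightarrow> 0 < F01 \<mu> d"
  by (simp add: F01_eq_stiefel_lap stiefel_lap_pos)

text \<open>On the manifold \<open>A \<bullet> X\<close> exceeds \<open>B \<bullet> X\<close> by at
  most \<open>norm (A - B)\<close> times sqrt p, so the logarithm of the Laplace transform is
  Lipschitz.\<close>

lemma stiefel_lap_le:
  fixes A B :: "('n::{finite,linorder},'p::{finite,linorder}) rmat"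
  assumes \<mu>: "haar_stiefel \<mu>"
  shows "stiefel_lap \<mu> A \<le> exp (norm (A - B) * sqrt CARD('p)) * stiefel_lap \<mu> B"
proof -
  have "stiefel_lap \<mu> A \<le> (\<integral>X. exp (norm (A - B) * sqrt CARD('p)) * exp (B \<bullet> X) \<partial>\<mu>)"
    unfolding stiefel_lap_def
  proof (rule integral_mono_AE)
    show "AE X in \<mu>. exp (A \<bullet> X) \<le> exp (norm (A - B) * sqrt CARD('p)) * exp (B \<bullet> X)"
      using haar_stiefel_AE[OF \<mu>]
    proof eventually_elim
      case (elim X)
      then have "A \<bullet> X \<le> norm (A - B) * sqrt CARD('p) + B \<bullet> X"
        using inner_le_stiefel[OF elim, of "A - B"] by (simp add: inner_diff_left abs_le_iff)
      then show ?case
        by (simp flip: exp_add)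
    qed
  qed (intro integrable_mult_right integrable_exp_inner \<mu>)+
  then show ?thesis
    by (simp add: stiefel_lap_def)
qed

lemma f_ML_pos: "haar_stiefel \<mu> \<Longrightarrow> 0 < f_ML \<mu> X t"
  by (simp add: f_ML_eq F01_pos)

text \<open>Writing \<open>M = Q ** diag_embed\<close> exhibits the natural parameter as the one in
  \<open>F01\<close>, multiplied by orthogonal matrices on the left and on the right.\<close>

lemma integral_f_ML:
  fixes M :: "('n::{finite,linorder},'p::{finite,linorder}) rmat"
  assumes card: "CARD('p) \<le> CARD('n)" and \<mu>: "haar_stiefel \<mu>"
    and M: "M \<in> stiefel" and V: "V \<in> stiefel"
  shows "(\<integral>X. f_ML \<mu> X (M, d, V) \<partial>\<mu>) = 1"
proof -
  obtain Q where Q: "orthogonal_matrix Q" "Q ** diag_embed = M"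
    using orthogonal_transitive_stiefel[OF diag_embed_stiefel[OF card] M] by metis
  \<comment> \<open>A square matrix with orthonormal columns also has orthonormal rows.\<close>
  have V': "orthogonal_matrix (transpose V)"
    using V by (simp add: orthogonal_matrix_transpose orthogonal_matrix_def stiefel_def matrix_left_right_inverse)
  have "langevin_par (M, d, V) = Q ** (diag_embed ** diag_mat d ** transpose V)"
    by (simp add: matrix_mul_assoc Q(2))
  then have "stiefel_lap \<mu> (langevin_par (M, d, V)) = F01 \<mu> d"
    by (simp add: stiefel_lap_mult_left[OF \<mu> Q(1)] stiefel_lap_mult_right[OF \<mu> V'] F01_eq_stiefel_lap)
  then show ?thesis
    using F01_pos[OF \<mu>, of d] by (simp add: f_ML_eq stiefel_lap_def)
qed

text \<open>Numerator and normalizing constant each change by at most an exponential factor in the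
  distance of their matrix arguments. The factor does not involve \<open>X\<close>, so the
  likelihood can be bounded along arbitrary samples.\<close>

lemma f_ML_ratio:
  fixes t t0 :: "('n::{finite,linorder},'p::{finite,linorder}) comp"
  assumes \<mu>: "haar_stiefel \<mu>" and X: "X \<in> stiefel"
  shows "exp (- (norm (langevin_par t0 - langevin_par t) +
      norm (diag_embed ** diag_mat (fst (snd t)) - diag_embed ** diag_mat (fst (snd t0)) :: ('n,'p) rmat))
        * sqrt CARD('p)) * f_ML \<mu> X t0 \<le> f_ML \<mu> X t"
proof -
  define a where "a = norm (langevin_par t0 - langevin_par t) * sqrt CARD('p)"
  define b where "b = norm (diag_embed ** diag_mat (fst (snd t)) - diag_embed ** diag_mat (fst (snd t0)) :: ('n,'p) rmat)
    * sqrt CARD('p)"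
  have F: "F01 \<mu> (fst (snd t)) \<le> exp b * F01 \<mu> (fst (snd t0))"
    unfolding F01_eq_stiefel_lap b_def by (rule stiefel_lap_le[OF \<mu>])
  have "langevin_par t0 \<bullet> X \<le> a + langevin_par t \<bullet> X"
    using inner_le_stiefel[OF X, of "langevin_par t0 - langevin_par t"]
    by (simp add: inner_diff_left abs_le_iff a_def)
  then have E: "exp (langevin_par t0 \<bullet> X) \<le> exp a * exp (langevin_par t \<bullet> X)"
    by (simp flip: exp_add)
  have "exp (langevin_par t0 \<bullet> X) * F01 \<mu> (fst (snd t))
      \<le> (exp a * exp (langevin_par t \<bullet> X)) * (exp b * F01 \<mu> (fst (snd t0)))"
    using F E F01_pos[OF \<mu>, of "fst (snd t)"] by (intro mult_mono) auto
  then have "exp (- (a + b)) * f_ML \<mu> X t0 \<le> f_ML \<mu> X t"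
    using F01_pos[OF \<mu>, of "fst (snd t)"] F01_pos[OF \<mu>, of "fst (snd t0)"]
    by (simp add: f_ML_eq field_simps exp_minus exp_add exp_diff)
  then show ?thesis
    by (simp add: a_def b_def algebra_simps)
qed

lemma continuous_diag_mat [continuous_intros]:
  "continuous_on S f \<Longrightarrow> continuous_on S (\<lambda>x. diag_mat (f x))"
  unfolding diag_mat_def by (intro continuous_on_vec_lambda, rename_tac i j, case_tac "i = j")
    (auto intro!: continuous_intros)

lemma langevin_par_eq: "langevin_par t = fst t ** diag_mat (fst (snd t)) ** transpose (snd (snd t))"
  by (cases t) simp

lemma continuous_langevin_par [continuous_intros]:
  "continuous_on S f \<Longrightarrow> continuous_on S (\<lambda>x. langevin_par (f x))"
  unfolding langevin_par_eq by (intro continuous_intros)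

lemma f_ML_lower_nbhd:
  fixes t0 :: "('n::{finite,linorder},'p::{finite,linorder}) comp"
  assumes \<mu>: "haar_stiefel \<mu>" and "0 < \<delta>"
  obtains W where "open W" "t0 \<in> W"
    "\<And>t X. t \<in> W \<Longrightarrow> X \<in> stiefel \<Longrightarrow> exp (- \<delta>) * f_ML \<mu> X t0 \<le> f_ML \<mu> X t"
proof
  let ?r = "\<lambda>t. (norm (langevin_par t0 - langevin_par t) +
      norm (diag_embed ** diag_mat (fst (snd t)) - diag_embed ** diag_mat (fst (snd t0)) :: ('n,'p) rmat))
        * sqrt CARD('p)"
  show "open {t. ?r t < \<delta>}"
    by (intro open_Collect_less continuous_intros)
  show "t0 \<in> {t. ?r t < \<delta>}"
    using \<open>0 < \<delta>\<close> by simp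
  show "exp (- \<delta>) * f_ML \<mu> X t0 \<le> f_ML \<mu> X t" if "t \<in> {t. ?r t < \<delta>}" "X \<in> stiefel" for t X
  proof (rule order_trans[OF mult_right_mono f_ML_ratio[OF \<mu> that(2)]])
    show "exp (- \<delta>) \<le> exp (- (norm (langevin_par t0 - langevin_par t) +
      norm (diag_embed ** diag_mat (fst (snd t)) - diag_embed ** diag_mat (fst (snd t0)) :: ('n,'p) rmat))
        * sqrt CARD('p))"
      using that(1) by (simp only: exp_le_cancel_iff mem_Collect_eq minus_mult_left[symmetric] neg_le_iff_le less_imp_le)
  qed (use f_ML_pos[OF \<mu>] in \<open>simp add: less_imp_le\<close>)
qed

section \<open>Joint measurability of the component densities\<close>

lemma borel_measurable_F01:
  fixes \<mu> :: "('n::{finite,linorder},'p::{finite,linorder}) rmat measure"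
  assumes \<mu>: "haar_stiefel \<mu>"
  shows "F01 \<mu> \<in> borel_measurable borel"
proof -
  interpret prob_space \<mu> by (rule haar_stiefel_prob[OF \<mu>])
  note [measurable_cong] = haar_stiefel_sets[OF \<mu>]
  have [measurable]: "(\<lambda>d. diag_embed ** diag_mat d :: ('n,'p) rmat) \<in> borel_measurable borel"
    by (intro borel_measurable_continuous_onI continuous_intros)
  have "F01 \<mu> = (\<lambda>d. \<integral>X. exp ((diag_embed ** diag_mat d) \<bullet> X) \<partial>\<mu>)"
    by (simp add: fun_eq_iff F01_eq_stiefel_lap stiefel_lap_def)
  then show ?thesis
    by simp
qed

lemma borel_measurable_langevin_par [measurable]: "langevin_par \<in> borel_measurable borel"
  by (intro borel_measurable_continuous_onI continuous_intros)

lemma borel_measurable_f_ML: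
  fixes \<mu> :: "('n::{finite,linorder},'p::{finite,linorder}) rmat measure"
  assumes \<mu>: "haar_stiefel \<mu>"
  shows "(\<lambda>z. f_ML \<mu> (fst z) (snd z)) \<in> borel_measurable (borel \<Otimes>\<^sub>M borel)"
proof -
  note [measurable] = borel_measurable_F01[OF \<mu>]
  have [measurable]: "(\<lambda>t :: ('n,'p) comp. fst (snd t)) \<in> borel \<rightarrow>\<^sub>M borel"
    by (intro borel_measurable_continuous_onI continuous_intros)
  show ?thesis
    unfolding f_ML_eq by measurable
qed

section \<open>The mixture density\<close>

abbreviation param_space :: "('c::{finite,linorder},'n::{finite,linorder},'p::{finite,linorder}) param measure" where
  "param_space \<equiv> PiM UNIV (\<lambda>_. borel) \<Otimes>\<^sub>M PiM UNIV (\<lambda>_. borel)"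

lemma borel_measurable_f_mix:
  assumes \<mu>: "haar_stiefel \<mu>"
  shows "(\<lambda>z. f_mix \<mu> (fst z) (snd z)) \<in> borel_measurable (borel \<Otimes>\<^sub>M param_space)"
proof -
  have [measurable]: "(\<lambda>z. f_ML \<mu> (fst z) (fst (snd z) c)) \<in> borel_measurable (borel \<Otimes>\<^sub>M param_space)" for c
    by (rule measurable_compose[OF _ borel_measurable_f_ML[OF \<mu>], of "\<lambda>z. (fst z, fst (snd z) c)", simplified])
       measurable
  show ?thesis
    unfolding f_mix_def by measurable
qed

lemma f_mix_pos:
  assumes "haar_stiefel \<mu>" "snd \<xi> \<in> prob_simplex"
  shows "0 < f_mix \<mu> X \<xi>"
  unfolding f_mix_def using assms
  by (intro sum_pos) (auto simp: prob_simplex_def f_ML_pos)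

lemma integrable_f_ML: "haar_stiefel \<mu> \<Longrightarrow> integrable \<mu> (\<lambda>X. f_ML \<mu> X t)"
  unfolding f_ML_eq by (intro integrable_divide integrable_exp_inner)

lemma nn_integral_f_mix:
  fixes \<xi> :: "('c::{finite,linorder},'n::{finite,linorder},'p::{finite,linorder}) param"
  assumes "CARD('p) \<le> CARD('n)" and \<mu>: "haar_stiefel \<mu>" and \<xi>: "\<xi> \<in> Xi"
  shows "integrable \<mu> (\<lambda>X. f_mix \<mu> X \<xi>)" "(\<integral>X. f_mix \<mu> X \<xi> \<partial>\<mu>) = 1"
    "(\<integral>\<^sup>+X. ennreal (f_mix \<mu> X \<xi>) \<partial>\<mu>) = 1"
proof -
  show int: "integrable \<mu> (\<lambda>X. f_mix \<mu> X \<xi>)"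
    unfolding f_mix_def by (intro Bochner_Integration.integrable_sum integrable_mult_right integrable_f_ML \<mu>)
  have "(\<integral>X. f_ML \<mu> X (fst \<xi> c) \<partial>\<mu>) = 1" for c
    using \<xi> integral_f_ML[OF assms(1) \<mu>, of "fst (fst \<xi> c)" "snd (snd (fst \<xi> c))" "fst (snd (fst \<xi> c))"]
    by (auto simp: Xi_def stiefel_pos_def)
  then show "(\<integral>X. f_mix \<mu> X \<xi> \<partial>\<mu>) = 1"
    using \<xi> unfolding f_mix_def
    by (subst Bochner_Integration.integral_sum)
       (auto intro!: integrable_mult_right integrable_f_ML \<mu> simp: Xi_def prob_simplex_def)
  then show "(\<integral>\<^sup>+X. ennreal (f_mix \<mu> X \<xi>) \<partial>\<mu>) = 1"
    using \<xi> by (subst nn_integral_eq_integral[OF int])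
      (auto intro!: AE_I2 less_imp_le f_mix_pos[OF \<mu>] simp: Xi_def)
qed

section \<open>Exponentially small posterior numerators\<close>

lemma ennreal_suminf_tendsto_0:
  fixes f :: "nat \<Rightarrow> ennreal"
  assumes "(\<Sum>n. f n) \<noteq> \<infinity>"
  shows "f \<longlonglongrightarrow> 0"
proof -
  have "f n \<noteq> \<infinity>" for n
  proof -
    have "sum f {n} \<le> (\<Sum>n. f n)"
      by (rule sum_le_suminf) auto
    then show ?thesis
      using assms by (auto simp: top_unique)
  qed
  then have f: "f = (\<lambda>n. ennreal (enn2real (f n)))"
    by (auto simp: fun_eq_iff less_top)
  have "summable (\<lambda>n. enn2real (f n))"
    using assms by (subst (asm) f) (intro summable_suminf_not_top, auto)
  then have "(\<lambda>n. enn2real (f n)) \<longlonglongrightarrow> 0"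
    by (rule summable_LIMSEQ_zero)
  then show ?thesis
    by (subst f, subst ennreal_tendsto_0_iff) auto
qed

text \<open>A Borel-Cantelli argument: half of the decay rate is spent on the weight, and the
  remaining expectations of order \<open>sqrt \<rho> ^ N\<close> are summable, so almost surely the
  series converges and its terms vanish.\<close>

lemma AE_geometric_tendsto_0:
  assumes u [measurable]: "\<And>N. u N \<in> borel_measurable M"
    and bound: "\<And>N. (\<integral>\<^sup>+x. u N x \<partial>M) \<le> K * ennreal (\<rho> ^ N)"
    and "K < \<infinity>" "0 < \<rho>" "\<rho> < 1"
  shows "AE x in M. (\<lambda>N. ennreal ((1 / sqrt \<rho>) ^ N) * u N x) \<longlonglongrightarrow> 0"
proof -
  define s where "s = 1 / sqrt \<rho>"
  have s: "s ^ N * \<rho> ^ N = sqrt \<rho> ^ N" for N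
    using \<open>0 < \<rho>\<close> by (simp add: s_def field_simps flip: power_mult_distrib)
  have "s \<ge> 0"
    using \<open>0 < \<rho>\<close> by (simp add: s_def)
  have "(\<integral>\<^sup>+x. (\<Sum>N. ennreal (s ^ N) * u N x) \<partial>M) = (\<Sum>N. \<integral>\<^sup>+x. ennreal (s ^ N) * u N x \<partial>M)"
    by (rule nn_integral_suminf) measurable
  also have "\<dots> = (\<Sum>N. ennreal (s ^ N) * (\<integral>\<^sup>+x. u N x \<partial>M))"
    by (simp add: nn_integral_cmult)
  also have "\<dots> \<le> (\<Sum>N. ennreal (s ^ N) * (K * ennreal (\<rho> ^ N)))"
    by (intro suminf_le mult_left_mono bound) auto
  also have "\<dots> = (\<Sum>N. K * ennreal (sqrt \<rho> ^ N))"
    using \<open>s \<ge> 0\<close> \<open>0 < \<rho>\<close> by (simp add: mult.left_commute s flip: ennreal_mult)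
  also have "\<dots> = K * (\<Sum>N. ennreal (sqrt \<rho> ^ N))"
    by (rule ennreal_suminf_cmult)
  also have "\<dots> < \<infinity>"
  proof -
    have "(\<Sum>N. ennreal (sqrt \<rho> ^ N)) \<noteq> top"
      using \<open>0 < \<rho>\<close> \<open>\<rho> < 1\<close> by (intro ennreal_suminf_neq_top summable_geometric) auto
    then show ?thesis
      using \<open>K < \<infinity>\<close> by (simp add: ennreal_mult_less_top less_top)
  qed
  finally have "AE x in M. (\<Sum>N. ennreal (s ^ N) * u N x) \<noteq> \<infinity>"
    by (intro nn_integral_noteq_infinite) auto
  then show ?thesis
    by eventually_elim (simp add: ennreal_suminf_tendsto_0 flip: s_def)
qed

text \<open>The integrand sees only the first \<open>N\<close> coordinates, so the infinite product
  may be replaced by its finite marginal, where the integral of a product splits.\<close>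

lemma nn_integral_PiM_prod_lessThan:
  assumes "prob_space M" and [measurable]: "v \<in> borel_measurable M"
  shows "(\<integral>\<^sup>+x. (\<Prod>i<N. v (x i)) \<partial>PiM UNIV (\<lambda>_::nat. M)) = (\<integral>\<^sup>+x. v x \<partial>M) ^ N"
proof -
  interpret M: prob_space M by fact
  interpret product_prob_space "\<lambda>_::nat. M" UNIV by unfold_locales
  interpret finite_product_sigma_finite "\<lambda>_::nat. M" "{..<N}" by unfold_locales simp
  have "(\<integral>\<^sup>+x. (\<Prod>i<N. v (x i)) \<partial>PiM UNIV (\<lambda>_::nat. M))
      = (\<integral>\<^sup>+x. (\<Prod>i<N. v (restrict x {..<N} i)) \<partial>PiM UNIV (\<lambda>_::nat. M))"
    by simp
  also have "\<dots> = (\<integral>\<^sup>+x. (\<Prod>i<N. v (x i)) \<partial>distr (PiM UNIV (\<lambda>_::nat. M)) (PiM {..<N} (\<lambda>_. M)) (\<lambda>x. restrict x {..<N}))"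
    by (rule nn_integral_distr[symmetric]) (rule measurable_restrict_subset, simp, measurable)
  also have "\<dots> = (\<integral>\<^sup>+x. (\<Prod>i<N. v (x i)) \<partial>PiM {..<N} (\<lambda>_. M))"
    by (subst distr_PiM_restrict_finite) auto
  also have "\<dots> = (\<integral>\<^sup>+x. v x \<partial>M) ^ N"
    by (subst product_nn_integral_prod) auto
  finally show ?thesis .
qed

text \<open>The integrated likelihood ratio over \<open>A\<close> factors as \<open>a' N x * b' N x\<close>, where the exponential
  tilt \<open>b'\<close> plays the role of a test: both factors have expectation \<open>O(\<rho> ^ N)\<close>.\<close>

lemma integrated_likelihood_exponentially_small:
  fixes r :: "'x \<Rightarrow> 'k \<Rightarrow> ennreal"
  assumes "prob_space P" "finite_measure Pr"
    and r: "(\<lambda>z. r (fst z) (snd z)) \<in> borel_measurable (P \<Otimes>\<^sub>M Pr)"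
    and A [measurable]: "A \<in> sets Pr" and y [measurable]: "y \<in> borel_measurable P"
    and a: "\<And>k. k \<in> A \<Longrightarrow> (\<integral>\<^sup>+x. r x k * ennreal (exp (- y x)) \<partial>P) \<le> ennreal \<rho>"
    and b: "(\<integral>\<^sup>+x. ennreal (exp (y x)) \<partial>P) \<le> ennreal \<rho>"
    and \<rho>: "0 < \<rho>" "\<rho> < 1"
  shows "AE x in PiM UNIV (\<lambda>_::nat. P).
    (\<lambda>N. ennreal ((1 / \<rho>) ^ N) * (\<integral>\<^sup>+k. indicator A k * (\<Prod>i<N. r (x i) k) \<partial>Pr)) \<longlonglongrightarrow> 0"
proof -
  interpret P: prob_space P by fact
  interpret Pr: finite_measure Pr by fact
  interpret PP: product_prob_space "\<lambda>_::nat. P" UNIV by unfold_locales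
  let ?Q = "PiM UNIV (\<lambda>_::nat. P)"
  interpret Q: pair_sigma_finite ?Q Pr by unfold_locales
  have r1 [measurable]: "(\<lambda>z. r (fst z i) (snd z)) \<in> borel_measurable (?Q \<Otimes>\<^sub>M Pr)" for i
    using measurable_compose[OF _ r, of "\<lambda>z. (fst z i, snd z)" "?Q \<Otimes>\<^sub>M Pr"] by simp
  have r2 [measurable]: "(\<lambda>x. r x k) \<in> borel_measurable P" if "k \<in> space Pr" for k
    using measurable_compose[OF _ r, of "\<lambda>x. (x, k)" P] that by simp
  define F where "F N x k = indicator A k * (\<Prod>i<N. r (x i) k * ennreal (exp (- y (x i))))"
    for N and x :: "nat \<Rightarrow> 'x" and k
  have F [measurable]: "(\<lambda>z. F N (fst z) (snd z)) \<in> borel_measurable (?Q \<Otimes>\<^sub>M Pr)" for N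
    unfolding F_def by measurable
  define a' where "a' N x = (\<integral>\<^sup>+k. F N x k \<partial>Pr)" for N x
  define b' where "b' N x = (\<Prod>i<N. ennreal (exp (y (x i))))" for N and x :: "nat \<Rightarrow> 'x"
  have a'_meas: "a' N \<in> borel_measurable ?Q" for N
    unfolding a'_def using Pr.borel_measurable_nn_integral[of "F N" ?Q] F[of N]
    by (simp add: case_prod_beta')
  have b'_meas: "b' N \<in> borel_measurable ?Q" for N
    unfolding b'_def by measurable
  have a'_int: "(\<integral>\<^sup>+x. a' N x \<partial>?Q) \<le> emeasure Pr (space Pr) * ennreal (\<rho> ^ N)" for N
  proof -
    \<comment> \<open>Fubini puts the sample integral inside, where the bound for a single fixed
      \<open>k\<close> in \<open>A\<close> applies.\<close>
    have "(\<integral>\<^sup>+x. a' N x \<partial>?Q) = (\<integral>\<^sup>+k. (\<integral>\<^sup>+x. F N x k \<partial>?Q) \<partial>Pr)"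
      unfolding a'_def using Q.Fubini'[of "F N"] F[of N] by (simp add: case_prod_beta')
    also have "\<dots> \<le> (\<integral>\<^sup>+k. ennreal (\<rho> ^ N) \<partial>Pr)"
    proof (rule nn_integral_mono)
      fix k assume k: "k \<in> space Pr"
      note [measurable] = r2[OF k]
      show "(\<integral>\<^sup>+x. F N x k \<partial>?Q) \<le> ennreal (\<rho> ^ N)"
      proof (cases "k \<in> A")
        case True
        then have "(\<integral>\<^sup>+x. F N x k \<partial>?Q) = (\<integral>\<^sup>+x. r x k * ennreal (exp (- y x)) \<partial>P) ^ N"
          unfolding F_def
            using nn_integral_PiM_prod_lessThan[OF assms(1), of "\<lambda>x. r x k * ennreal (exp (- y x))" N] by simp
        also have "\<dots> \<le> ennreal \<rho> ^ N"
          by (intro power_mono a True) simp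
        finally show ?thesis
          using \<rho> by (simp add: ennreal_power)
      qed (simp add: F_def)
    qed
    finally show ?thesis
      by (simp add: mult.commute)
  qed
  have b'_int: "(\<integral>\<^sup>+x. b' N x \<partial>?Q) \<le> 1 * ennreal (\<rho> ^ N)" for N
  proof -
    have "(\<integral>\<^sup>+x. b' N x \<partial>?Q) = (\<integral>\<^sup>+x. ennreal (exp (y x)) \<partial>P) ^ N"
      unfolding b'_def by (rule nn_integral_PiM_prod_lessThan[OF assms(1)]) measurable
    also have "\<dots> \<le> ennreal \<rho> ^ N"
      by (intro power_mono b) simp
    finally show ?thesis
      using \<rho> by (simp add: ennreal_power)
  qed
  have "AE x in ?Q. (\<lambda>N. ennreal ((1 / sqrt \<rho>) ^ N) * a' N x) \<longlonglongrightarrow> 0"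
    by (rule AE_geometric_tendsto_0[OF a'_meas a'_int]) (use \<rho> in \<open>simp_all flip: less_top\<close>)
  moreover have "AE x in ?Q. (\<lambda>N. ennreal ((1 / sqrt \<rho>) ^ N) * b' N x) \<longlonglongrightarrow> 0"
    by (rule AE_geometric_tendsto_0[OF b'_meas b'_int]) (use \<rho> in auto)
  moreover have "AE x in ?Q. x \<in> space ?Q"
    by simp
  ultimately show ?thesis
  proof eventually_elim
    case (elim x)
    have x: "x i \<in> space P" for i
      using elim(3) by (auto simp: space_PiM)
    \<comment> \<open>The tilts \<open>exp (- y)\<close> and \<open>exp y\<close> cancel, and each
      factor takes half of the weight, matching the two almost sure limits just obtained.\<close>
    have "ennreal ((1 / \<rho>) ^ N) * (\<integral>\<^sup>+k. indicator A k * (\<Prod>i<N. r (x i) k) \<partial>Pr)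
      = (ennreal ((1 / sqrt \<rho>) ^ N) * a' N x) * (ennreal ((1 / sqrt \<rho>) ^ N) * b' N x)" for N
    proof -
      have F_x: "F N x \<in> borel_measurable Pr"
        using measurable_compose[OF _ F[of N], of "\<lambda>k. (x, k)" Pr] elim(3) by simp
      have "(1 / \<rho>) ^ N = (1 / sqrt \<rho>) ^ N * (1 / sqrt \<rho>) ^ N"
        using \<rho> by (simp flip: power_mult_distrib)
      then have 1: "ennreal ((1 / \<rho>) ^ N) = ennreal ((1 / sqrt \<rho>) ^ N) * ennreal ((1 / sqrt \<rho>) ^ N)"
        using \<rho> by (simp flip: ennreal_mult)
      have "indicator A k * (\<Prod>i<N. r (x i) k) = F N x k * b' N x" for k
      proof -
        have "r (x i) k = (r (x i) k * ennreal (exp (- y (x i)))) * ennreal (exp (y (x i)))" for i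
          by (simp add: mult.assoc flip: ennreal_mult exp_add)
        then have "(\<Prod>i<N. r (x i) k) = (\<Prod>i<N. (r (x i) k * ennreal (exp (- y (x i)))) * ennreal (exp (y (x i))))"
          by simp
        then show ?thesis
          by (simp add: F_def b'_def prod.distrib mult.assoc)
      qed
      then have "(\<integral>\<^sup>+k. indicator A k * (\<Prod>i<N. r (x i) k) \<partial>Pr) = a' N x * b' N x"
        unfolding a'_def using F_x by (simp add: nn_integral_multc)
      then show ?thesis
        by (simp add: 1 mult_ac)
    qed
    then show ?case
      using tendsto_mult_ennreal[OF elim(1,2)] by simp
  qed
qed

section \<open>Exponential tilts separating mixture expectations\<close>

lemma exp_minus_le_quadratic:
  fixes z :: real
  assumes "\<bar>z\<bar> \<le> 1"
  shows "exp (- z) \<le> 1 - z + z\<^sup>2"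
proof (cases "0 \<le> z")
  case True
  have "exp (- z) * (1 + z) \<le> 1"
    using exp_ge_add_one_self[of z] mult_left_mono[of "1 + z" "exp z" "exp (- z)"]
    by (simp flip: exp_add)
  \<comment> \<open>The product on the right equals 1 + z^3.\<close>
  also have "\<dots> \<le> (1 - z + z\<^sup>2) * (1 + z)"
    using True by (simp add: algebra_simps power2_eq_square)
  finally show ?thesis
    using True by (simp add: mult_le_cancel_right)
next
  case False
  then show ?thesis
    using exp_bound[of "- z"] assms by simp
qed

text \<open>Second order expansion of the tilt: the linear term gains at least \<open>l * e\<close>
  while the quadratic term costs at most \<open>(l * B)\<^sup>2\<close>, so for positive
  \<open>e\<close> a small positive \<open>l\<close> brings the bound below 1.\<close>

lemma tilted_nn_integral_le:
  fixes w Y :: "'x \<Rightarrow> real"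
  assumes w: "integrable M w" "(\<integral>x. w x \<partial>M) = 1" "\<And>x. 0 \<le> w x"
    and Y: "Y \<in> borel_measurable M" "\<And>x. \<bar>Y x\<bar> \<le> B" "e \<le> (\<integral>x. w x * Y x \<partial>M)"
    and l: "0 \<le> l" "l * B \<le> 1"
  shows "(\<integral>\<^sup>+x. ennreal (w x) * ennreal (exp (- (l * Y x))) \<partial>M) \<le> ennreal (1 - l * e + (l * B)\<^sup>2)"
proof -
  have int: "integrable M (\<lambda>x. w x * Y x)"
    by (rule Bochner_Integration.integrable_bound[of M "\<lambda>x. B * w x"])
       (use w Y in \<open>auto intro!: AE_I2 simp: abs_mult mult.commute[of B] intro: mult_left_mono order_trans[OF _ abs_ge_self]\<close>)
  have int2: "integrable M (\<lambda>x. w x - l * (w x * Y x) + (l * B)\<^sup>2 * w x)"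
    using w int by auto
  have pw: "w x * exp (- (l * Y x)) \<le> w x - l * (w x * Y x) + (l * B)\<^sup>2 * w x" for x
  proof -
    have le: "\<bar>l * Y x\<bar> \<le> l * B"
      using l Y(2)[of x] by (simp add: abs_mult mult_left_mono)
    then have "exp (- (l * Y x)) \<le> 1 - l * Y x + (l * Y x)\<^sup>2"
      using l by (intro exp_minus_le_quadratic) simp
    also have "(l * Y x)\<^sup>2 \<le> (l * B)\<^sup>2"
      using le by (simp add: abs_le_square_iff[symmetric])
    finally have "w x * exp (- (l * Y x)) \<le> w x * (1 - l * Y x + (l * B)\<^sup>2)"
      using w(3) by (intro mult_left_mono) auto
    then show ?thesis
      by (simp add: algebra_simps)
  qed
  \<comment> \<open>The upper bound dominates a nonnegative function, which permits evaluating its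
    nonnegative integral as a Bochner integral.\<close>
  have nonneg: "0 \<le> w x - l * (w x * Y x) + (l * B)\<^sup>2 * w x" for x
    using w(3)[of x] by (intro order_trans[OF _ pw]) simp
  have "(\<integral>\<^sup>+x. ennreal (w x) * ennreal (exp (- (l * Y x))) \<partial>M)
      \<le> (\<integral>\<^sup>+x. ennreal (w x - l * (w x * Y x) + (l * B)\<^sup>2 * w x) \<partial>M)"
    using w(3) pw by (intro nn_integral_mono) (simp add: ennreal_leI flip: ennreal_mult)
  also have "\<dots> = ennreal (\<integral>x. w x - l * (w x * Y x) + (l * B)\<^sup>2 * w x \<partial>M)"
    using nonneg by (intro nn_integral_eq_integral int2) auto
  also have "(\<integral>x. w x - l * (w x * Y x) + (l * B)\<^sup>2 * w x \<partial>M)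
      = 1 - l * (\<integral>x. w x * Y x \<partial>M) + (l * B)\<^sup>2"
    using w int by simp
  also have "\<dots> \<le> 1 - l * e + (l * B)\<^sup>2"
    using Y(3) l by (simp add: mult_left_mono)
  finally show ?thesis
    by (simp add: ennreal_leI)
qed

lemma prob_space_true_dist:
  fixes \<xi>0 :: "('c::{finite,linorder},'n::{finite,linorder},'p::{finite,linorder}) param"
  assumes "CARD('p) \<le> CARD('n)" "haar_stiefel \<mu>" "\<xi>0 \<in> Xi"
  shows "prob_space (true_dist \<mu> \<xi>0)"
  unfolding true_dist_def
  using nn_integral_f_mix[OF assms]
  by (intro prob_spaceI) (subst emeasure_density, auto cong: nn_integral_cong)

section \<open>Measurability on the parameter space\<close>

lemma open_Sp: "open Sp"
  unfolding Sp_def Collect_conj_eq Collect_all_eq Collect_imp_eq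
  by (intro open_Int open_INT ballI open_Un open_Collect_less continuous_intros finite) auto

lemma stiefel_pos_eq: "stiefel_pos = stiefel \<inter> {X. \<forall>j. 0 < X $ first_row $ j}"
  by (auto simp: stiefel_pos_def)

lemma open_first_row_pos:
  "open {X :: ('n::{finite,linorder},'p::{finite,linorder}) rmat. \<forall>j. 0 < X $ first_row $ j}"
  unfolding Collect_all_eq
  by (intro open_INT ballI open_Collect_less continuous_intros finite)

lemma sets_Xi: "(Xi :: ('c::{finite,linorder},'n::{finite,linorder},'p::{finite,linorder}) param set) \<in> sets param_space"
proof -
  let ?K = "stiefel_pos \<times> (Sp \<times> stiefel) :: ('n,'p) comp set"
  have [measurable]: "?K \<in> sets borel"
  proof -
    have "?K \<in> sets (borel \<Otimes>\<^sub>M (borel \<Otimes>\<^sub>M borel))"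
      unfolding stiefel_pos_eq
      by (intro pair_measureI sets.Int borel_stiefel borel_open open_Sp open_first_row_pos)
    then show ?thesis
      by (simp only: borel_prod)
  qed
  have "Xi = {\<xi> \<in> space param_space. (\<forall>c. fst \<xi> c \<in> ?K) \<and> (\<forall>c. 0 < snd \<xi> c \<and> snd \<xi> c < 1)
      \<and> (\<Sum>c\<in>UNIV. snd \<xi> c) = 1}"
    by (auto simp: Xi_def prob_simplex_def space_pair_measure space_PiM mem_Times_iff)
  also have "\<dots> \<in> sets param_space"
    by measurable
  finally show ?thesis .
qed

lemma borel_measurable_f_mix_fst:
  assumes \<mu>: "haar_stiefel \<mu>"
  shows "(\<lambda>X. f_mix \<mu> X \<xi>) \<in> borel_measurable borel"
  using measurable_compose[OF _ borel_measurable_f_mix[OF \<mu>], of "\<lambda>X. (X, \<xi>)"]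
  by (simp add: space_pair_measure space_PiM)

lemma borel_measurable_f_mix_snd:
  assumes \<mu>: "haar_stiefel \<mu>"
  shows "f_mix \<mu> X \<in> borel_measurable param_space"
  using measurable_compose[OF measurable_Pair1' borel_measurable_f_mix[OF \<mu>], of X] by simp

text \<open>The expectation of \<open>g\<close> is the integral of a jointly measurable function,
  hence measurable in the parameter.\<close>

lemma sets_separated:
  fixes \<mu> :: "('n::{finite,linorder},'p::{finite,linorder}) rmat measure"
  assumes \<mu>: "haar_stiefel \<mu>" and [measurable]: "g \<in> borel_measurable borel"
  shows "{\<xi> \<in> (Xi :: ('c::{finite,linorder},'n,'p) param set). a \<le> (\<integral>X. g X * f_mix \<mu> X \<xi> \<partial>\<mu>)} \<in> sets param_space"
proof -
  interpret \<mu>: prob_space \<mu> by (rule haar_stiefel_prob[OF \<mu>])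
  note [measurable_cong] = haar_stiefel_sets[OF \<mu>]
  have [measurable]: "(\<lambda>z. f_mix \<mu> (snd z) (fst z)) \<in> borel_measurable (param_space \<Otimes>\<^sub>M borel)"
    using measurable_compose[OF measurable_Pair[OF measurable_snd measurable_fst] borel_measurable_f_mix[OF \<mu>]]
    by simp
  let ?S = "{\<xi> :: ('c,'n,'p) param. \<xi> \<in> space param_space \<and> a \<le> (\<integral>X. g X * f_mix \<mu> X \<xi> \<partial>\<mu>)}"
  have S: "?S \<in> sets param_space"
    by measurable
  have "{\<xi> \<in> Xi. a \<le> (\<integral>X. g X * f_mix \<mu> X \<xi> \<partial>\<mu>)} = Xi \<inter> ?S"
    by (auto simp: space_pair_measure space_PiM)
  then show ?thesis
    by (simp only: sets.Int[OF sets_Xi S])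
qed

text \<open>Supplies the tilt for \<open>integrated_likelihood_exponentially_small\<close>: the
  expectation of \<open>g\<close> tells \<open>A\<close> from the truth, and a small multiple of a
  centred \<open>g\<close> serves as \<open>y\<close>.\<close>

lemma mixture_posterior_numerator:
  fixes \<xi>0 :: "('c::{finite,linorder},'n::{finite,linorder},'p::{finite,linorder}) param"
  assumes card: "CARD('p) \<le> CARD('n)" and \<mu>: "haar_stiefel \<mu>" and \<xi>0: "\<xi>0 \<in> Xi"
    and g: "g \<in> borel_measurable borel" "\<And>X. \<bar>g X\<bar> \<le> B" and "0 < \<epsilon>"
    and Pr: "finite_measure Pr" "sets Pr = sets param_space"
  defines "A \<equiv> {\<xi> \<in> Xi. (\<integral>X. g X * f_mix \<mu> X \<xi>0 \<partial>\<mu>) + \<epsilon> \<le> (\<integral>X. g X * f_mix \<mu> X \<xi> \<partial>\<mu>)}"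
  obtains \<rho> where "0 < \<rho>" "\<rho> < 1"
    "AE Xs in PiM UNIV (\<lambda>_::nat. true_dist \<mu> \<xi>0). (\<lambda>N. ennreal ((1 / \<rho>) ^ N) *
      (\<integral>\<^sup>+\<xi>. indicator A \<xi> * ennreal (lik_ratio \<mu> \<xi>0 Xs N \<xi>) \<partial>Pr)) \<longlonglongrightarrow> 0"
proof -
  interpret \<mu>: prob_space \<mu> by (rule haar_stiefel_prob[OF \<mu>])
  note [measurable_cong] = haar_stiefel_sets[OF \<mu>] Pr(2)
  note [measurable] = g(1) borel_measurable_f_mix[OF \<mu>]
  note f_meas [measurable] = borel_measurable_f_mix_fst[OF \<mu>]
  have [measurable_cong]: "sets (true_dist \<mu> \<xi>0) = sets borel"
    by (simp add: true_dist_def haar_stiefel_sets[OF \<mu>])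
  have f_pos: "0 < f_mix \<mu> X \<xi>" if "\<xi> \<in> Xi" for X and \<xi> :: "('c,'n,'p) param"
    using that by (intro f_mix_pos[OF \<mu>]) (auto simp: Xi_def)
  have A: "A \<in> sets Pr"
    unfolding Pr(2) A_def by (rule sets_separated[OF \<mu> g(1)])
  define m where "m = (\<integral>X. g X * f_mix \<mu> X \<xi>0 \<partial>\<mu>)"
  \<comment> \<open>Centred halfway across the gap: the mean of \<open>Y\<close> is
    \<open>- \<epsilon> / 2\<close> under the truth and at least \<open>\<epsilon> / 2\<close> on
    \<open>A\<close>, so both tilt bounds come out with the same \<open>\<rho>\<close>.\<close>
  define Y where "Y X = g X - m - \<epsilon> / 2" for X
  have [measurable]: "Y \<in> borel_measurable borel"
    unfolding Y_def by measurable
  have int_g: "integrable \<mu> (\<lambda>X. g X * f_mix \<mu> X \<xi>)" if "\<xi> \<in> Xi" for \<xi> :: "('c,'n,'p) param"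
  proof (rule Bochner_Integration.integrable_bound)
    show "integrable \<mu> (\<lambda>X. B * f_mix \<mu> X \<xi>)"
      using nn_integral_f_mix(1)[OF card \<mu> that] by simp
    show "AE X in \<mu>. norm (g X * f_mix \<mu> X \<xi>) \<le> norm (B * f_mix \<mu> X \<xi>)"
      using g(2) by (auto simp: abs_mult intro!: AE_I2 mult_right_mono order_trans[OF _ abs_ge_self] less_imp_le[OF f_pos[OF that]])
  qed measurable
  have int_Y: "(\<integral>X. f_mix \<mu> X \<xi> * Y X \<partial>\<mu>) = (\<integral>X. g X * f_mix \<mu> X \<xi> \<partial>\<mu>) - m - \<epsilon> / 2"
    if "\<xi> \<in> Xi" for \<xi> :: "('c,'n,'p) param"
  proof -
    have "f_mix \<mu> X \<xi> * Y X = g X * f_mix \<mu> X \<xi> - (m + \<epsilon> / 2) * f_mix \<mu> X \<xi>" for X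
      by (simp add: Y_def algebra_simps)
    then show ?thesis
      using int_g[OF that] nn_integral_f_mix(1,2)[OF card \<mu> that] by simp
  qed
  \<comment> \<open>Bounds \<open>Y\<close>; the summand \<open>\<epsilon>\<close> also gives
    \<open>\<epsilon> \<le> C\<close>, which keeps \<open>\<rho>\<close> positive.\<close>
  define C where "C = B + \<bar>m\<bar> + \<epsilon>"
  have "0 \<le> B"
    using g(2)[of undefined] by linarith
  have C: "\<epsilon> \<le> C" "\<bar>Y X\<bar> \<le> C" for X
    using g(2)[of X] \<open>0 \<le> B\<close> \<open>0 < \<epsilon>\<close> by (auto simp: C_def Y_def)
  \<comment> \<open>The minimizer of the bound
    \<open>1 - l * (\<epsilon> / 2) + (l * C)\<^sup>2\<close>: the quadratic cost is then half of
    the linear gain.\<close>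
  define l where "l = \<epsilon> / (4 * C\<^sup>2)"
  have "0 < C" using C(1) \<open>0 < \<epsilon>\<close> by linarith
  then have "0 < l" using \<open>0 < \<epsilon>\<close> by (simp add: l_def)
  have lC: "l * C \<le> 1 / 4" "l * C * (l * C) = l * \<epsilon> / 4"
    using C(1) \<open>0 < C\<close> by (simp_all add: l_def field_simps power2_eq_square)
  have "l * \<epsilon> \<le> l * C"
    using C(1) \<open>0 < l\<close> by simp
  define \<rho> where "\<rho> = 1 - l * (\<epsilon> / 2) + (l * C)\<^sup>2"
  have \<rho>_eq: "\<rho> = 1 - l * \<epsilon> / 4"
    using lC(2) unfolding \<rho>_def power2_eq_square by linarith
  have "0 < l * \<epsilon>"
    using \<open>0 < l\<close> \<open>0 < \<epsilon>\<close> by simp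
  then have \<rho>: "0 < \<rho>" "\<rho> < 1"
    using \<open>l * \<epsilon> \<le> l * C\<close> lC(1) unfolding \<rho>_eq by linarith+
  let ?r = "\<lambda>X \<xi>. ennreal (f_mix \<mu> X \<xi> / f_mix \<mu> X \<xi>0)"
  have "AE Xs in PiM UNIV (\<lambda>_::nat. true_dist \<mu> \<xi>0). (\<lambda>N. ennreal ((1 / \<rho>) ^ N) *
      (\<integral>\<^sup>+\<xi>. indicator A \<xi> * (\<Prod>i<N. ?r (Xs i) \<xi>) \<partial>Pr)) \<longlonglongrightarrow> 0"
  proof (rule integrated_likelihood_exponentially_small[where y="\<lambda>X. l * Y X"])
    show "prob_space (true_dist \<mu> \<xi>0)"
      by (rule prob_space_true_dist[OF card \<mu> \<xi>0])
    show "(\<integral>\<^sup>+X. ?r X \<xi> * ennreal (exp (- (l * Y X))) \<partial>true_dist \<mu> \<xi>0) \<le> ennreal \<rho>" if "\<xi> \<in> A" for \<xi>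
    proof -
      have \<xi>: "\<xi> \<in> Xi" "\<epsilon> / 2 \<le> (\<integral>X. f_mix \<mu> X \<xi> * Y X \<partial>\<mu>)"
        using that int_Y[of \<xi>] by (auto simp: A_def m_def)
      \<comment> \<open>The density of the true distribution cancels the denominator of the
        likelihood ratio, leaving an integral against the mixture at \<open>\<xi>\<close>.\<close>
      have "ennreal (f_mix \<mu> X \<xi>0) * (?r X \<xi> * ennreal (exp (- (l * Y X))))
          = ennreal (f_mix \<mu> X \<xi>) * ennreal (exp (- (l * Y X)))" for X
        using f_pos[OF \<xi>(1), of X] f_pos[OF \<xi>0, of X] by (simp flip: ennreal_mult mult.assoc)
      then have "(\<integral>\<^sup>+X. ?r X \<xi> * ennreal (exp (- (l * Y X))) \<partial>true_dist \<mu> \<xi>0)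
          = (\<integral>\<^sup>+X. ennreal (f_mix \<mu> X \<xi>) * ennreal (exp (- (l * Y X))) \<partial>\<mu>)"
        unfolding true_dist_def by (subst nn_integral_density) simp_all
      also have "\<dots> \<le> ennreal \<rho>"
        unfolding \<rho>_def
        using nn_integral_f_mix(1,2)[OF card \<mu> \<xi>(1)] \<xi>(2) C(2) \<open>0 < l\<close> lC(1) f_pos[OF \<xi>(1)]
        by (intro tilted_nn_integral_le) (auto intro: less_imp_le)
      finally show ?thesis .
    qed
    show "(\<integral>\<^sup>+X. ennreal (exp (l * Y X)) \<partial>true_dist \<mu> \<xi>0) \<le> ennreal \<rho>"
    proof -
      have "(\<integral>\<^sup>+X. ennreal (exp (l * Y X)) \<partial>true_dist \<mu> \<xi>0)
          = (\<integral>\<^sup>+X. ennreal (f_mix \<mu> X \<xi>0) * ennreal (exp (- (l * - Y X))) \<partial>\<mu>)"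
        unfolding true_dist_def by (subst nn_integral_density) simp_all
      also have "\<dots> \<le> ennreal \<rho>"
        unfolding \<rho>_def
      proof (rule tilted_nn_integral_le)
        show "\<epsilon> / 2 \<le> (\<integral>X. f_mix \<mu> X \<xi>0 * - Y X \<partial>\<mu>)"
          using int_Y[OF \<xi>0] by (simp add: m_def)
      qed (use nn_integral_f_mix(1,2)[OF card \<mu> \<xi>0] C(2) \<open>0 < l\<close> lC(1) f_pos[OF \<xi>0] in \<open>auto intro: less_imp_le\<close>)
      finally show ?thesis .
    qed
  qed (use A Pr(1) \<rho> in simp_all)
  \<comment> \<open>Off \<open>Xi\<close> the ratios may be negative, and \<open>ennreal\<close>
    then fails to be multiplicative; the indicator removes those parameters.\<close>
  moreover have "indicator A \<xi> * (\<Prod>i<N. ?r (Xs i) \<xi>) = indicator A \<xi> * ennreal (lik_ratio \<mu> \<xi>0 Xs N \<xi>)" for N Xs \<xi>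
  proof (cases "\<xi> \<in> A")
    case True
    then have "\<xi> \<in> Xi" by (simp add: A_def)
    then show ?thesis
      using f_pos[of \<xi>] f_pos[OF \<xi>0] by (simp add: lik_ratio_def prod_ennreal less_imp_le)
  qed simp
  ultimately show thesis
    using that[OF \<rho>] by simp
qed

section \<open>Support of the prior\<close>

text \<open>A vanishing integral, in particular the default value for a non-integrable
  \<open>h\<close>, makes every quotient 0 and yields the null measure; otherwise \<open>h\<close>
  is integrable.\<close>

lemma finite_measure_normalized_density:
  assumes "\<And>x. 0 \<le> h x"
  shows "finite_measure (normalized_density M h)"
proof (cases "(\<integral>x. h x \<partial>M) = 0")
  case True
  then show ?thesis
    by (intro finite_measureI) (simp add: normalized_density_def emeasure_density)
next
  case False
  then have int: "integrable M h"
    using not_integrable_integral_eq by blast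
  have "0 \<le> (\<integral>x. h x \<partial>M)"
    using assms by simp
  then have "(\<integral>\<^sup>+x. ennreal (h x / (\<integral>x. h x \<partial>M)) \<partial>M) = ennreal (\<integral>x. h x / (\<integral>x. h x \<partial>M) \<partial>M)"
    using assms int by (intro nn_integral_eq_integral) auto
  moreover have "emeasure (normalized_density M h) (space M) = (\<integral>\<^sup>+x. ennreal (h x / (\<integral>x. h x \<partial>M)) \<partial>M)"
    unfolding normalized_density_def using borel_measurable_integrable[OF int]
    by (subst emeasure_density) (auto cong: nn_integral_cong)
  ultimately show ?thesis
    by (intro finite_measureI) (simp add: normalized_density_def)
qed

lemma AE_normalized_density_pos:
  assumes "\<And>x. 0 \<le> h x"
  shows "AE x in normalized_density M h. 0 < h x"
proof (cases "(\<integral>x. h x \<partial>M) = 0")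
  case True
  then show ?thesis
    unfolding normalized_density_def True by (subst AE_density) auto
next
  case False
  then have int: "integrable M h"
    using not_integrable_integral_eq by blast
  show ?thesis
    unfolding normalized_density_def using borel_measurable_integrable[OF int] assms
    by (subst AE_density) (auto simp: less_le)
qed

lemma emeasure_normalized_density_pos:
  assumes h: "\<And>x. 0 \<le> h x" and A: "A \<in> sets M" and "B \<in> sets M" "B \<subseteq> A"
    and pos: "\<And>x. x \<in> B \<Longrightarrow> 0 < h x" "emeasure M B \<noteq> 0"
    and nz: "emeasure (normalized_density M h) (space M) \<noteq> 0"
  shows "emeasure (normalized_density M h) A \<noteq> 0"
proof
  assume null: "emeasure (normalized_density M h) A = 0"
  \<comment> \<open>Nonzero total mass rules out the degenerate case, so \<open>h\<close> is
    integrable with positive integral.\<close>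
  have nz': "(\<integral>x. h x \<partial>M) \<noteq> 0"
    using nz by (auto simp: normalized_density_def emeasure_density)
  then have int: "integrable M h"
    using not_integrable_integral_eq by blast
  have "0 \<le> (\<integral>x. h x \<partial>M)"
    using h by simp
  with nz' have c: "0 < (\<integral>x. h x \<partial>M)" by simp
  note [measurable] = borel_measurable_integrable[OF int] A
  have "(\<integral>\<^sup>+x. ennreal (h x / (\<integral>x. h x \<partial>M)) * indicator A x \<partial>M) = 0"
    using null unfolding normalized_density_def by (subst (asm) emeasure_density) auto
  then have "AE x in M. ennreal (h x / (\<integral>x. h x \<partial>M)) * indicator A x = 0"
    by (subst (asm) nn_integral_0_iff_AE) auto
  then have "AE x in M. x \<notin> B"
  proof eventually_elim
    case (elim x)
    then show ?case
      using c pos(1)[of x] \<open>B \<subseteq> A\<close> by (auto simp: indicator_def divide_le_0_iff split: if_splits)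
  qed
  then have "emeasure M B = 0"
    using \<open>B \<in> sets M\<close> sets.sets_into_space[OF \<open>B \<in> sets M\<close>]
    by (subst (asm) AE_iff_measurable[of B]) auto
  then show False
    using pos(2) by simp
qed

section \<open>The priors of the single parameters\<close>

lemma sets_prior_M: "haar_stiefel \<mu> \<Longrightarrow> sets (prior_M \<mu> G) = sets borel"
  by (simp add: prior_M_def normalized_density_def haar_stiefel_sets)

lemma sets_prior_V: "haar_stiefel \<mu>p \<Longrightarrow> sets (prior_V \<mu>p H) = sets borel"
  by (simp add: prior_V_def normalized_density_def haar_stiefel_sets)

lemma sets_prior_d: "sets (prior_d \<mu> \<nu> \<eta>) = sets borel"
  by (simp add: prior_d_def normalized_density_def)

lemma sets_dirichlet: "sets (dirichlet \<alpha>) = sets (PiM UNIV (\<lambda>_. borel))"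
  by (simp add: dirichlet_def normalized_density_def)

lemma finite_measure_prior_M: "finite_measure (prior_M \<mu> G)"
  unfolding prior_M_def by (rule finite_measure_normalized_density) simp

lemma finite_measure_prior_V: "finite_measure (prior_V \<mu>p H)"
  unfolding prior_V_def by (rule finite_measure_normalized_density) simp

lemma finite_measure_prior_d: "finite_measure (prior_d \<mu> \<nu> \<eta>)"
  unfolding prior_d_def by (rule finite_measure_normalized_density) simp

lemma finite_measure_dirichlet: "finite_measure (dirichlet \<alpha>)"
  unfolding dirichlet_def by (rule finite_measure_normalized_density) (simp add: prod_nonneg)

lemma haar_stiefel_open_pos:
  assumes \<mu>: "haar_stiefel \<mu>" and X: "X \<in> stiefel" and U: "open U" "X \<in> U"
  shows "emeasure \<mu> (U \<inter> stiefel) \<noteq> 0"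
proof -
  interpret prob_space \<mu> by (rule haar_stiefel_prob[OF \<mu>])
  note [measurable_cong] = haar_stiefel_sets[OF \<mu>]
  obtain r where r: "0 < r" "ball X r \<subseteq> U"
    using U open_contains_ball by blast
  have "0 < emeasure \<mu> (ball X r)"
    using haar_stiefel_measure_ball_pos[OF \<mu> X r(1)] by (simp add: emeasure_eq_measure)
  also have "\<dots> \<le> emeasure \<mu> U"
    using U(1) r(2) haar_stiefel_sets[OF \<mu>] by (intro emeasure_mono) auto
  also have "\<dots> = emeasure \<mu> (U \<inter> stiefel)"
    using haar_stiefel_AE[OF \<mu>] U(1) haar_stiefel_sets[OF \<mu>]
    by (intro emeasure_eq_AE sets.Int) (auto elim!: eventually_mono)
  finally show ?thesis by simp
qed

text \<open>The sign condition on the first row is open, so restricting to it leaves a neighbourhood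
  of \<open>X\<close> in the manifold, which Haar measure charges.\<close>

lemma emeasure_prior_M_pos:
  assumes \<mu>: "haar_stiefel \<mu>" and X: "X \<in> stiefel_pos" and U: "open U" "X \<in> U"
    and nz: "emeasure (prior_M \<mu> G) (space (prior_M \<mu> G)) \<noteq> 0"
  shows "emeasure (prior_M \<mu> G) U \<noteq> 0"
proof -
  let ?B = "(U \<inter> {X. \<forall>j. 0 < X $ first_row $ j}) \<inter> stiefel"
  show ?thesis
    unfolding prior_M_def
  proof (rule emeasure_normalized_density_pos[where B="?B"])
    show "emeasure \<mu> ?B \<noteq> 0"
      using X U by (intro haar_stiefel_open_pos[OF \<mu>, of X] open_Int open_first_row_pos) (auto simp: stiefel_pos_def)
    show "?B \<in> sets \<mu>"
      unfolding haar_stiefel_sets[OF \<mu>]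
      by (intro sets.Int borel_stiefel borel_open open_first_row_pos U(1))
  qed (use U(1) nz in \<open>auto simp: haar_stiefel_sets[OF \<mu>] stiefel_pos_def prior_M_def normalized_density_def\<close>)
qed

lemma emeasure_prior_V_pos:
  assumes \<mu>: "haar_stiefel \<mu>p" and X: "X \<in> stiefel" and U: "open U" "X \<in> U"
    and nz: "emeasure (prior_V \<mu>p H) (space (prior_V \<mu>p H)) \<noteq> 0"
  shows "emeasure (prior_V \<mu>p H) U \<noteq> 0"
  unfolding prior_V_def
proof (rule emeasure_normalized_density_pos[where B="U \<inter> stiefel"])
  show "emeasure \<mu>p (U \<inter> stiefel) \<noteq> 0"
    by (rule haar_stiefel_open_pos[OF \<mu> X U])
qed (use U(1) nz in \<open>auto simp: haar_stiefel_sets[OF \<mu>] prior_V_def normalized_density_def\<close>)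

text \<open>\<open>Sp\<close> is open, so \<open>U \<inter> Sp\<close> is a nonempty open set and
  has positive Lebesgue measure; there the unnormalized density is positive.\<close>

lemma emeasure_prior_d_pos:
  assumes \<mu>: "haar_stiefel \<mu>" and d: "d \<in> Sp" and U: "open U" "d \<in> U"
    and nz: "emeasure (prior_d \<mu> \<nu> \<eta>) (space (prior_d \<mu> \<nu> \<eta>)) \<noteq> 0"
  shows "emeasure (prior_d \<mu> \<nu> \<eta>) U \<noteq> 0"
  unfolding prior_d_def
proof (rule emeasure_normalized_density_pos[where B="U \<inter> Sp"])
  have "\<not> negligible (U \<inter> Sp)"
    using d U by (intro open_not_negligible open_Int open_Sp) auto
  then show "emeasure lborel (U \<inter> Sp) \<noteq> 0"
    using open_Int[OF U(1) open_Sp] by (auto simp: negligible_iff_emeasure0)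
  show "0 < indicator Sp x * exp (\<nu> * (\<eta> \<bullet> x)) / F01 \<mu> x powr \<nu>" if "x \<in> U \<inter> Sp" for x
    using that F01_pos[OF \<mu>, of x] by simp
qed (use U(1) nz open_Int[OF U(1) open_Sp] in \<open>auto simp: prior_d_def normalized_density_def\<close>)

lemma simplex_ext_measurable:
  "simplex_ext \<in> PiM (UNIV - {Max UNIV}) (\<lambda>_. lborel) \<rightarrow>\<^sub>M PiM UNIV (\<lambda>_. borel)"
proof (rule measurable_PiM_single')
  show "(\<lambda>x. simplex_ext x c) \<in> borel_measurable (PiM (UNIV - {Max UNIV}) (\<lambda>_. lborel))" for c
    by (cases "c = Max UNIV") (simp_all add: simplex_ext_def, measurable)
qed auto

lemma sets_prob_simplex: "(prob_simplex :: ('c::{finite,linorder} \<Rightarrow> real) set) \<in> sets (PiM UNIV (\<lambda>_. borel))"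
proof -
  have "{\<pi> \<in> space (PiM UNIV (\<lambda>_. borel)). (\<forall>c. 0 < \<pi> c \<and> \<pi> c < 1) \<and> (\<Sum>c\<in>(UNIV :: 'c set). \<pi> c) = (1::real)} \<in> sets (PiM UNIV (\<lambda>_. borel))"
    by measurable
  then show ?thesis
    by (simp add: prob_simplex_def space_PiM)
qed

text \<open>A box in the free coordinates suffices: keeping each of them strictly between
  \<open>\<kappa> * \<pi>0 c\<close> and \<open>\<pi>0 c\<close> can only push the remaining weight
  up, so that weight satisfies its lower bound as well.\<close>

lemma emeasure_dirichlet_pos:
  fixes \<pi>0 :: "'c::{finite,linorder} \<Rightarrow> real"
  assumes \<pi>0: "\<pi>0 \<in> prob_simplex" and \<kappa>: "0 < \<kappa>" "\<kappa> < 1"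
    and nz: "emeasure (dirichlet \<alpha>) (space (dirichlet \<alpha>)) \<noteq> 0"
  shows "emeasure (dirichlet \<alpha>) {\<pi>. \<forall>c. \<kappa> * \<pi>0 c < \<pi> c} \<noteq> 0"
proof -
  define m where "m = (Max UNIV :: 'c)"
  define I where "I = (UNIV :: 'c set) - {m}"
  let ?A = "{\<pi>. \<forall>c. \<kappa> * \<pi>0 c < \<pi> c}"
  have A: "?A \<in> sets (PiM UNIV (\<lambda>_. borel))"
  proof -
    have "{\<pi> \<in> space (PiM UNIV (\<lambda>_. borel)). \<forall>c. \<kappa> * \<pi>0 c < \<pi> c} \<in> sets (PiM UNIV (\<lambda>_. borel))"
      by measurable
    then show ?thesis
      by (simp add: space_PiM)
  qed
  have \<pi>0': "0 < \<pi>0 c" "\<pi>0 c < 1" for c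
    using \<pi>0 by (auto simp: prob_simplex_def)
  have sum0: "\<pi>0 m + (\<Sum>c\<in>I. \<pi>0 c) = 1"
    using \<pi>0 sum.remove[of UNIV m \<pi>0] by (simp add: prob_simplex_def I_def)
  interpret product_sigma_finite "\<lambda>_::'c. lborel :: real measure" by unfold_locales
  let ?box = "PiE I (\<lambda>c. {\<kappa> * \<pi>0 c <..< \<pi>0 c})"
  have box: "simplex_ext x \<in> ?A \<inter> prob_simplex" if "x \<in> ?box" for x
  proof -
    have x: "\<kappa> * \<pi>0 c < x c" "x c < \<pi>0 c" if "c \<in> I" for c
      using \<open>x \<in> ?box\<close> that by (auto simp: PiE_iff)
    have pos: "0 < x c" if "c \<in> I" for c
      using x(1)[OF that] mult_pos_pos[OF \<kappa>(1) \<pi>0'(1)[of c]] by linarith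
    \<comment> \<open>A single component would have weight 1, which \<open>prob_simplex\<close>
      excludes. Some free coordinate is thus present and keeps the last weight below 1.\<close>
    have "I \<noteq> {}"
      using sum0 \<pi>0'(2)[of m] by auto
    then have S: "0 < (\<Sum>c\<in>I. x c)"
      by (intro sum_pos pos) (auto simp: I_def)
    have S0: "(\<Sum>c\<in>I. x c) \<le> (\<Sum>c\<in>I. \<pi>0 c)"
      by (intro sum_mono less_imp_le x)
    have ext: "simplex_ext x c = (if c = m then 1 - (\<Sum>c\<in>I. x c) else x c)" for c
      by (simp add: simplex_ext_def m_def I_def)
    have \<kappa>m: "\<kappa> * \<pi>0 m < \<pi>0 m"
      using \<kappa> \<pi>0'(1)[of m] by simp
    have 1: "\<kappa> * \<pi>0 c < simplex_ext x c" "0 < simplex_ext x c" "simplex_ext x c < 1" for c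
    proof -
      have "\<kappa> * \<pi>0 c < simplex_ext x c \<and> 0 < simplex_ext x c \<and> simplex_ext x c < 1"
      proof (cases "c = m")
        case True
        then show ?thesis
          using S S0 sum0 \<kappa>m \<pi>0'(1)[of m] unfolding ext by (simp only: True if_True) linarith
      next
        case False
        then have "c \<in> I" by (simp add: I_def)
        then show ?thesis
          using x[of c] pos[of c] \<pi>0'(2)[of c] False by (simp add: ext)
      qed
      then show "\<kappa> * \<pi>0 c < simplex_ext x c" "0 < simplex_ext x c" "simplex_ext x c < 1"
        by auto
    qed
    have "(\<Sum>c\<in>UNIV. simplex_ext x c) = simplex_ext x m + (\<Sum>c\<in>I. simplex_ext x c)"
      unfolding I_def by (rule sum.remove) auto
    also have "(\<Sum>c\<in>I. simplex_ext x c) = (\<Sum>c\<in>I. x c)"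
      by (intro sum.cong) (auto simp: ext I_def)
    finally show ?thesis
      using 1 by (simp add: prob_simplex_def ext)
  qed
  have box_sets: "?box \<in> sets (PiM I (\<lambda>_. lborel))"
    by (intro sets_PiM_I_finite) (auto simp: I_def)
  have "emeasure (PiM I (\<lambda>_. lborel)) ?box = (\<Prod>c\<in>I. emeasure lborel {\<kappa> * \<pi>0 c <..< \<pi>0 c})"
    by (rule emeasure_PiM) (auto simp: I_def)
  also have "\<dots> \<noteq> 0"
    using \<kappa> \<pi>0' by (auto simp: I_def ennreal_eq_0_iff not_le)
  finally have pos: "0 < emeasure (PiM I (\<lambda>_. lborel)) ?box"
    by (simp add: zero_less_iff_neq_zero)
  have sx: "simplex_ext \<in> PiM I (\<lambda>_. lborel) \<rightarrow>\<^sub>M PiM UNIV (\<lambda>_. borel)"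
    using simplex_ext_measurable by (simp add: I_def m_def)
  have "emeasure (PiM I (\<lambda>_. lborel)) ?box
      \<le> emeasure (PiM I (\<lambda>_. lborel)) (simplex_ext -` (?A \<inter> prob_simplex) \<inter> space (PiM I (\<lambda>_. lborel)))"
    using sets.sets_into_space[OF box_sets] box
    by (intro emeasure_mono measurable_sets[OF sx] sets.Int A sets_prob_simplex) auto
  also have "\<dots> = emeasure (distr (PiM I (\<lambda>_. lborel)) (PiM UNIV (\<lambda>_. borel)) simplex_ext) (?A \<inter> prob_simplex)"
    by (intro emeasure_distr[symmetric] sx sets.Int A sets_prob_simplex)
  finally have nz': "emeasure (distr (PiM I (\<lambda>_. lborel)) (PiM UNIV (\<lambda>_. borel)) simplex_ext) (?A \<inter> prob_simplex) \<noteq> 0"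
    using pos by auto
  show ?thesis
    unfolding dirichlet_def
  proof (rule emeasure_normalized_density_pos[where B="?A \<inter> prob_simplex"])
    show "0 < indicator prob_simplex x * (\<Prod>c\<in>UNIV. x c powr (\<alpha> c - 1))" if "x \<in> ?A \<inter> prob_simplex" for x
      using that by (auto intro!: prod_pos simp: prob_simplex_def less_imp_neq[THEN not_sym])
    show "emeasure (distr (PiM (UNIV - {Max UNIV}) (\<lambda>_. lborel)) (PiM UNIV (\<lambda>_. borel)) simplex_ext) (?A \<inter> prob_simplex) \<noteq> 0"
      using nz' by (simp add: I_def m_def)
    show "emeasure (normalized_density (distr (PiM (UNIV - {Max UNIV}) (\<lambda>_. lborel)) (PiM UNIV (\<lambda>_. borel)) simplex_ext)
         (\<lambda>\<pi>. indicator prob_simplex \<pi> * (\<Prod>c\<in>UNIV. \<pi> c powr (\<alpha> c - 1))))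
         (space (distr (PiM (UNIV - {Max UNIV}) (\<lambda>_. lborel)) (PiM UNIV (\<lambda>_. borel)) simplex_ext)) \<noteq> 0"
      using nz by (simp add: dirichlet_def normalized_density_def)
  qed (use A sets_prob_simplex in \<open>auto simp: prod_nonneg\<close>)
qed

section \<open>The joint prior\<close>

lemma finite_measure_PiM:
  assumes "finite I" and M: "\<And>i. finite_measure (M i)"
  shows "finite_measure (PiM I M)"
proof -
  interpret product_sigma_finite M
    using M by (simp add: product_sigma_finite_def finite_measure.axioms(1) finite_measure_def)
  have "emeasure (PiM I M) (space (PiM I M)) = (\<Prod>i\<in>I. emeasure (M i) (space (M i)))"
    unfolding space_PiM by (rule emeasure_PiM[OF \<open>finite I\<close>]) auto
  also have "\<dots> \<noteq> \<infinity>"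
    using finite_measure.emeasure_finite[OF M]
    by (simp add: ennreal_prod_eq_top infinity_ennreal_def)
  finally show ?thesis
    by (intro finite_measureI) simp
qed

abbreviation comp_prior where
  "comp_prior \<mu> \<mu>p G H \<nu> \<eta> c \<equiv> prior_M \<mu> (G c) \<Otimes>\<^sub>M (prior_d \<mu> (\<nu> c) (\<eta> c) \<Otimes>\<^sub>M prior_V \<mu>p (H c))"

lemma finite_measure_comp_prior: "finite_measure (comp_prior \<mu> \<mu>p G H \<nu> \<eta> c)"
  by (intro finite_measure_pair_measure finite_measure_prior_M finite_measure_prior_d finite_measure_prior_V)

lemma finite_measure_prior: "finite_measure (prior \<mu> \<mu>p G H \<nu> \<eta> \<alpha>)"
  unfolding prior_def
  by (intro finite_measure_pair_measure finite_measure_PiM finite_measure_dirichlet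
      finite_measure_prior_M finite_measure_prior_d finite_measure_prior_V) simp

lemma sets_comp_prior:
  fixes \<mu> :: "('n::{finite,linorder},'p::{finite,linorder}) rmat measure"
  assumes "haar_stiefel \<mu>" "haar_stiefel \<mu>p"
  shows "sets (comp_prior \<mu> \<mu>p G H \<nu> \<eta> c) = sets borel"
proof -
  have "sets (comp_prior \<mu> \<mu>p G H \<nu> \<eta> c) = sets (borel \<Otimes>\<^sub>M (borel \<Otimes>\<^sub>M borel))"
    by (intro sets_pair_measure_cong sets_prior_M sets_prior_d sets_prior_V assms)
  then show ?thesis
    by (simp only: borel_prod)
qed

lemma sets_prior:
  assumes "haar_stiefel \<mu>" "haar_stiefel \<mu>p"
  shows "sets (prior \<mu> \<mu>p G H \<nu> \<eta> \<alpha>) = sets param_space"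
  unfolding prior_def
  by (intro sets_pair_measure_cong sets_PiM_cong sets_comp_prior sets_dirichlet assms refl)

text \<open>Off the simplex mixtures can be negative, so nonnegativity of the likelihood ratio is
  obtained only almost everywhere, through this fact.\<close>

lemma AE_prior_simplex: "AE \<xi> in prior \<mu> \<mu>p G H \<nu> \<eta> \<alpha>. snd \<xi> \<in> prob_simplex"
proof -
  let ?P = "PiM UNIV (comp_prior \<mu> \<mu>p G H \<nu> \<eta>)"
  interpret P: finite_measure ?P
    by (intro finite_measure_PiM finite_measure_comp_prior) simp
  interpret D: finite_measure "dirichlet \<alpha>" by (rule finite_measure_dirichlet)
  interpret pair_sigma_finite ?P "dirichlet \<alpha>" by unfold_locales
  have "AE \<pi> in dirichlet \<alpha>. 0 < indicator prob_simplex \<pi> * (\<Prod>c\<in>UNIV. \<pi> c powr (\<alpha> c - 1))"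
    unfolding dirichlet_def by (rule AE_normalized_density_pos) (simp add: prod_nonneg)
  then have ae: "AE \<pi> in dirichlet \<alpha>. \<pi> \<in> prob_simplex"
    by (rule eventually_mono) (rule ccontr, simp)
  show ?thesis
    unfolding prior_def
  proof (rule AE_pair_measure)
    have [measurable]: "prob_simplex \<in> sets (dirichlet \<alpha>)"
      by (simp add: sets_dirichlet sets_prob_simplex)
    show "{x \<in> space (?P \<Otimes>\<^sub>M dirichlet \<alpha>). snd x \<in> prob_simplex} \<in> sets (?P \<Otimes>\<^sub>M dirichlet \<alpha>)"
      by measurable
    show "AE x in ?P. AE y in dirichlet \<alpha>. snd (x, y) \<in> prob_simplex"
      using ae by simp
  qed
qed

lemma emeasure_comp_prior_Times:
  assumes "A \<in> sets (prior_M \<mu> (G c))" "B \<in> sets (prior_d \<mu> (\<nu> c) (\<eta> c))" "C \<in> sets (prior_V \<mu>p (H c))"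
  shows "emeasure (comp_prior \<mu> \<mu>p G H \<nu> \<eta> c) (A \<times> B \<times> C) =
    emeasure (prior_M \<mu> (G c)) A * (emeasure (prior_d \<mu> (\<nu> c) (\<eta> c)) B * emeasure (prior_V \<mu>p (H c)) C)"
proof -
  interpret V: finite_measure "prior_V \<mu>p (H c)" by (rule finite_measure_prior_V)
  interpret D: finite_measure "prior_d \<mu> (\<nu> c) (\<eta> c)" by (rule finite_measure_prior_d)
  interpret DV: finite_measure "prior_d \<mu> (\<nu> c) (\<eta> c) \<Otimes>\<^sub>M prior_V \<mu>p (H c)"
    by (intro finite_measure_pair_measure finite_measure_prior_d finite_measure_prior_V)
  show ?thesis
    using assms by (simp add: DV.emeasure_pair_measure_Times V.emeasure_pair_measure_Times)
qed

text \<open>A box of open sets around \<open>t\<close> fits inside \<open>W\<close>, and its mass is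
  a product. Nonzero total mass of the product forces each factor to be nondegenerate.\<close>

lemma emeasure_comp_prior_pos:
  assumes \<mu>: "haar_stiefel \<mu>" "haar_stiefel \<mu>p"
    and t: "fst t \<in> stiefel_pos" "fst (snd t) \<in> Sp" "snd (snd t) \<in> stiefel"
    and W: "open W" "t \<in> W"
    and nz: "emeasure (comp_prior \<mu> \<mu>p G H \<nu> \<eta> c) (space (comp_prior \<mu> \<mu>p G H \<nu> \<eta> c)) \<noteq> 0"
  shows "emeasure (comp_prior \<mu> \<mu>p G H \<nu> \<eta> c) W \<noteq> 0"
proof -
  obtain A B' where A: "open A" "open B'" "t \<in> A \<times> B'" "A \<times> B' \<subseteq> W"
    using open_prod_elim[OF W] by metis
  then have "snd t \<in> B'" by (auto simp: mem_Times_iff)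
  then obtain B C where B: "open B" "open C" "snd t \<in> B \<times> C" "B \<times> C \<subseteq> B'"
    using open_prod_elim[OF A(2)] by metis
  have nz': "emeasure (prior_M \<mu> (G c)) (space (prior_M \<mu> (G c))) \<noteq> 0"
    "emeasure (prior_d \<mu> (\<nu> c) (\<eta> c)) (space (prior_d \<mu> (\<nu> c) (\<eta> c))) \<noteq> 0"
    "emeasure (prior_V \<mu>p (H c)) (space (prior_V \<mu>p (H c))) \<noteq> 0"
    using nz by (auto simp: space_pair_measure emeasure_comp_prior_Times)
  have "emeasure (prior_M \<mu> (G c)) A \<noteq> 0"
    using A(3) by (intro emeasure_prior_M_pos[OF \<mu>(1) t(1) A(1) _ nz'(1)]) (simp add: mem_Times_iff)
  moreover have "emeasure (prior_d \<mu> (\<nu> c) (\<eta> c)) B \<noteq> 0"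
    using B(3) by (intro emeasure_prior_d_pos[OF \<mu>(1) t(2) B(1) _ nz'(2)]) (simp add: mem_Times_iff)
  moreover have "emeasure (prior_V \<mu>p (H c)) C \<noteq> 0"
    using B(3) by (intro emeasure_prior_V_pos[OF \<mu>(2) t(3) B(2) _ nz'(3)]) (simp add: mem_Times_iff)
  ultimately have "0 < emeasure (comp_prior \<mu> \<mu>p G H \<nu> \<eta> c) (A \<times> B \<times> C)"
    using A(1) B(1,2)
    by (subst emeasure_comp_prior_Times) (simp_all add: sets_prior_M[OF \<mu>(1)] sets_prior_V[OF \<mu>(2)] sets_prior_d zero_less_iff_neq_zero)
  also have "\<dots> \<le> emeasure (comp_prior \<mu> \<mu>p G H \<nu> \<eta> c) W"
    using A(4) B(4) W(1) by (intro emeasure_mono) (auto simp only: sets_comp_prior[OF \<mu>] borel_open)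
  finally show ?thesis by simp
qed

text \<open>\<open>K\<close> collects parameters near the true components whose weights have not
  dropped by more than the factor \<open>\<kappa>\<close>. It is a product set, so its mass reduces
  to the separate factors.\<close>

lemma emeasure_prior_nbhd_pos:
  fixes \<xi>0 :: "('c::{finite,linorder},'n::{finite,linorder},'p::{finite,linorder}) param"
  assumes \<mu>: "haar_stiefel \<mu>" "haar_stiefel \<mu>p" and \<xi>0: "\<xi>0 \<in> Xi"
    and W: "\<And>c. open (W c)" "\<And>c. fst \<xi>0 c \<in> W c" and \<kappa>: "0 < \<kappa>" "\<kappa> < 1"
    and nz: "emeasure (prior \<mu> \<mu>p G H \<nu> \<eta> \<alpha>) (space (prior \<mu> \<mu>p G H \<nu> \<eta> \<alpha>)) \<noteq> 0"
  defines "K \<equiv> PiE UNIV W \<times> {\<pi>. \<forall>c. \<kappa> * snd \<xi>0 c < \<pi> c}"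
  shows "K \<in> sets (prior \<mu> \<mu>p G H \<nu> \<eta> \<alpha>)" "emeasure (prior \<mu> \<mu>p G H \<nu> \<eta> \<alpha>) K \<noteq> 0"
proof -
  let ?P = "PiM UNIV (comp_prior \<mu> \<mu>p G H \<nu> \<eta>)"
  interpret D: finite_measure "dirichlet \<alpha>" by (rule finite_measure_dirichlet)
  interpret product_sigma_finite "comp_prior \<mu> \<mu>p G H \<nu> \<eta>"
    by (rule product_sigma_finite.intro) (rule finite_measure.axioms(1)[OF finite_measure_comp_prior])
  have W_sets: "W c \<in> sets (comp_prior \<mu> \<mu>p G H \<nu> \<eta> c)" for c
    using W(1) by (simp only: sets_comp_prior[OF \<mu>] borel_open)
  have 1: "PiE UNIV W \<in> sets ?P"
    using W_sets by (intro sets_PiM_I_finite) auto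
  have 2: "{\<pi>. \<forall>c. \<kappa> * snd \<xi>0 c < \<pi> c} \<in> sets (dirichlet \<alpha>)"
  proof -
    have "{\<pi> \<in> space (PiM UNIV (\<lambda>_. borel)). \<forall>c. \<kappa> * snd \<xi>0 c < \<pi> c} \<in> sets (PiM UNIV (\<lambda>_. borel))"
      by measurable
    then show ?thesis
      by (simp add: space_PiM sets_dirichlet)
  qed
  show "K \<in> sets (prior \<mu> \<mu>p G H \<nu> \<eta> \<alpha>)"
    unfolding K_def prior_def by (intro pair_measureI 1 2)
  have "emeasure ?P (space ?P) * emeasure (dirichlet \<alpha>) (space (dirichlet \<alpha>)) \<noteq> 0"
    using nz unfolding prior_def space_pair_measure
    by (subst (asm) D.emeasure_pair_measure_Times) auto
  moreover have "emeasure ?P (space ?P)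
      = (\<Prod>c\<in>UNIV. emeasure (comp_prior \<mu> \<mu>p G H \<nu> \<eta> c) (space (comp_prior \<mu> \<mu>p G H \<nu> \<eta> c)))"
    unfolding space_PiM by (rule emeasure_PiM) auto
  ultimately have nz': "emeasure (comp_prior \<mu> \<mu>p G H \<nu> \<eta> c) (space (comp_prior \<mu> \<mu>p G H \<nu> \<eta> c)) \<noteq> 0"
    "emeasure (dirichlet \<alpha>) (space (dirichlet \<alpha>)) \<noteq> 0" for c
    by auto
  have \<theta>0: "fst (fst \<xi>0 c) \<in> stiefel_pos" "fst (snd (fst \<xi>0 c)) \<in> Sp" "snd (snd (fst \<xi>0 c)) \<in> stiefel" for c
    using \<xi>0 by (auto simp: Xi_def)
  have "emeasure (comp_prior \<mu> \<mu>p G H \<nu> \<eta> c) (W c) \<noteq> 0" for c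
    by (rule emeasure_comp_prior_pos[where G=G and H=H and \<nu>=\<nu> and \<eta>=\<eta> and c=c and t="fst \<xi>0 c",
          OF \<mu> \<theta>0 W nz'(1)])
  then have "emeasure ?P (PiE UNIV W) \<noteq> 0"
    using W_sets by (subst emeasure_PiM) auto
  moreover have "emeasure (dirichlet \<alpha>) {\<pi>. \<forall>c. \<kappa> * snd \<xi>0 c < \<pi> c} \<noteq> 0"
    using \<xi>0 by (intro emeasure_dirichlet_pos \<kappa> nz'(2)) (auto simp: Xi_def)
  ultimately show "emeasure (prior \<mu> \<mu>p G H \<nu> \<eta> \<alpha>) K \<noteq> 0"
    unfolding K_def prior_def by (subst D.emeasure_pair_measure_Times[OF 1 2]) simp
qed

section \<open>Posterior consistency\<close>

text \<open>On the compact manifold a small perturbation of the parameter changes the density by a factor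
  uniformly close to one, so the Kullback--Leibler support condition holds in a uniform form and the
  lower bound is valid for every sample sequence.\<close>

lemma posterior_denominator:
  fixes \<xi>0 :: "('c::{finite,linorder},'n::{finite,linorder},'p::{finite,linorder}) param"
  assumes \<mu>: "haar_stiefel \<mu>" "haar_stiefel \<mu>p" and \<xi>0: "\<xi>0 \<in> Xi" and \<rho>: "0 < \<rho>" "\<rho> < 1"
    and nz: "emeasure (prior \<mu> \<mu>p G H \<nu> \<eta> \<alpha>) (space (prior \<mu> \<mu>p G H \<nu> \<eta> \<alpha>)) \<noteq> 0"
  obtains k where "0 < k" "\<And>Xs N. (\<And>i. Xs i \<in> stiefel) \<Longrightarrow>
    integrable (prior \<mu> \<mu>p G H \<nu> \<eta> \<alpha>) (lik_ratio \<mu> \<xi>0 Xs N) \<Longrightarrow>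
    \<rho> ^ N * k \<le> (\<integral>\<xi>. lik_ratio \<mu> \<xi>0 Xs N \<xi> \<partial>prior \<mu> \<mu>p G H \<nu> \<eta> \<alpha>)"
proof -
  let ?Pr = "prior \<mu> \<mu>p G H \<nu> \<eta> \<alpha>"
  interpret Pr: finite_measure ?Pr by (rule finite_measure_prior)
  \<comment> \<open>The permitted loss \<open>\<rho>\<close> is shared equally between the weights
    and the component densities.\<close>
  define \<kappa> where "\<kappa> = sqrt \<rho>"
  have \<kappa>: "0 < \<kappa>" "\<kappa> < 1" "\<kappa> * \<kappa> = \<rho>"
    using \<rho> by (auto simp: \<kappa>_def)
  have "0 < - ln \<kappa>"
    using \<kappa> by simp
  then have "\<exists>W. open W \<and> t0 \<in> W \<and> (\<forall>t X. t \<in> W \<longrightarrow> X \<in> stiefel \<longrightarrow> \<kappa> * f_ML \<mu> X t0 \<le> f_ML \<mu> X t)"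
    for t0 :: "('n,'p) comp"
    using f_ML_lower_nbhd[OF \<mu>(1), of "- ln \<kappa>" t0] \<kappa>(1) by (metis exp_ln minus_minus)
  then have "\<forall>c. \<exists>W. open W \<and> fst \<xi>0 c \<in> W \<and>
      (\<forall>t X. t \<in> W \<longrightarrow> X \<in> stiefel \<longrightarrow> \<kappa> * f_ML \<mu> X (fst \<xi>0 c) \<le> f_ML \<mu> X t)"
    by simp
  then obtain W where W: "\<And>c. open (W c)" "\<And>c. fst \<xi>0 c \<in> W c"
    "\<And>c t X. t \<in> W c \<Longrightarrow> X \<in> stiefel \<Longrightarrow> \<kappa> * f_ML \<mu> X (fst \<xi>0 c) \<le> f_ML \<mu> X t"
    by (drule_tac choice) blast
  define K where "K = PiE UNIV W \<times> {\<pi>. \<forall>c. \<kappa> * snd \<xi>0 c < \<pi> c}"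
  have K: "K \<in> sets ?Pr" "emeasure ?Pr K \<noteq> 0"
    unfolding K_def by (rule emeasure_prior_nbhd_pos[OF \<mu> \<xi>0 W(1,2) \<kappa>(1,2) nz])+
  have \<pi>0: "0 < snd \<xi>0 c" "snd \<xi>0 \<in> prob_simplex" for c
    using \<xi>0 by (auto simp: Xi_def prob_simplex_def)
  have ratio: "\<rho> \<le> f_mix \<mu> X \<xi> / f_mix \<mu> X \<xi>0" if "\<xi> \<in> K" "X \<in> stiefel" for \<xi> X
  proof -
    have "\<rho> * f_mix \<mu> X \<xi>0 = (\<Sum>c\<in>UNIV. (\<kappa> * snd \<xi>0 c) * (\<kappa> * f_ML \<mu> X (fst \<xi>0 c)))"
      by (simp add: f_mix_def sum_distrib_left mult_ac flip: \<kappa>(3))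
    also have "\<dots> \<le> (\<Sum>c\<in>UNIV. snd \<xi> c * f_ML \<mu> X (fst \<xi> c))"
    proof (intro sum_mono mult_mono)
      fix c
      show "\<kappa> * snd \<xi>0 c \<le> snd \<xi> c"
        using that by (auto simp: K_def less_imp_le)
      show "\<kappa> * f_ML \<mu> X (fst \<xi>0 c) \<le> f_ML \<mu> X (fst \<xi> c)"
        using that by (intro W(3)) (auto simp: K_def PiE_iff)
      have "0 < \<kappa> * snd \<xi>0 c"
        using \<kappa>(1) \<pi>0 by simp
      also have "\<dots> < snd \<xi> c"
        using that by (auto simp: K_def)
      finally show "0 \<le> snd \<xi> c" by simp
      show "0 \<le> \<kappa> * f_ML \<mu> X (fst \<xi>0 c)"
        using \<kappa>(1) f_ML_pos[OF \<mu>(1)] by (simp add: less_imp_le)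
    qed
    also have "\<dots> = f_mix \<mu> X \<xi>"
      by (simp add: f_mix_def)
    finally show ?thesis
      using f_mix_pos[OF \<mu>(1) \<pi>0(2), of X] by (simp add: le_divide_eq)
  qed
  show thesis
  proof
    show "0 < measure ?Pr K"
      using K(2) by (simp add: Pr.emeasure_eq_measure zero_less_measure_iff)
    fix Xs :: "nat \<Rightarrow> ('n,'p) rmat" and N
    assume Xs: "\<And>i. Xs i \<in> stiefel" and int: "integrable ?Pr (lik_ratio \<mu> \<xi>0 Xs N)"
    have "\<rho> ^ N * measure ?Pr K = (\<integral>\<xi>. \<rho> ^ N * indicator K \<xi> \<partial>?Pr)"
      using K(1) by simp
    also have "\<dots> \<le> (\<integral>\<xi>. lik_ratio \<mu> \<xi>0 Xs N \<xi> \<partial>?Pr)"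
    proof (rule integral_mono_AE)
      show "integrable ?Pr (\<lambda>\<xi>. \<rho> ^ N * indicator K \<xi>)"
        using K(1) by (simp add: Pr.emeasure_eq_measure)
      show "AE \<xi> in ?Pr. \<rho> ^ N * indicator K \<xi> \<le> lik_ratio \<mu> \<xi>0 Xs N \<xi>"
        using AE_prior_simplex
      proof eventually_elim
        case (elim \<xi>)
        show ?case
        proof (cases "\<xi> \<in> K")
          case True
          have "(\<Prod>i<N. \<rho>) \<le> lik_ratio \<mu> \<xi>0 Xs N \<xi>"
            unfolding lik_ratio_def using \<rho> ratio[OF True Xs] by (intro prod_mono) auto
          then show ?thesis
            using True by simp
        next
          \<comment> \<open>Outside \<open>K\<close> only nonnegativity of the likelihood ratio is
            required, and that holds on the simplex.\<close>
          case False
          then show ?thesis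
            using f_mix_pos[OF \<mu>(1) elim] f_mix_pos[OF \<mu>(1) \<pi>0(2)]
            by (auto simp: lik_ratio_def intro!: prod_pos divide_pos_pos less_imp_le[of 0])
        qed
      qed
    qed (rule int)
    finally show "\<rho> ^ N * measure ?Pr K \<le> (\<integral>\<xi>. lik_ratio \<mu> \<xi>0 Xs N \<xi> \<partial>?Pr)" .
  qed
qed

text \<open>A test function need not be measurable off the manifold, in which case its integrals against
  all mixture densities are the junk value \<open>0\<close> and it imposes no constraint.\<close>

lemma weak_nbhd_complement_cover:
  fixes \<xi>0 :: "('c::{finite,linorder},'n::{finite,linorder},'p::{finite,linorder}) param"
  assumes \<mu>: "haar_stiefel \<mu>" and \<xi>0: "\<xi>0 \<in> Xi" and U: "weak_nbhd \<mu> \<xi>0 U"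
  obtains T \<epsilon> where "finite T" "0 < \<epsilon>" "\<And>t. t \<in> T \<Longrightarrow> t \<in> borel_measurable borel"
    "\<And>t. t \<in> T \<Longrightarrow> \<exists>B. \<forall>X. \<bar>t X\<bar> \<le> B"
    "Xi - U \<subseteq> (\<Union>t\<in>T. {\<xi> \<in> Xi. (\<integral>X. t X * f_mix \<mu> X \<xi>0 \<partial>\<mu>) + \<epsilon> \<le> (\<integral>X. t X * f_mix \<mu> X \<xi> \<partial>\<mu>)})"
proof -
  note [measurable_cong] = haar_stiefel_sets[OF \<mu>]
  obtain \<epsilon> \<G> where \<epsilon>: "0 < \<epsilon>" and \<G>: "finite \<G>"
      "\<And>g. g \<in> \<G> \<Longrightarrow> continuous_on stiefel g \<and> bounded (g ` stiefel)"
      "{\<xi> \<in> Xi. \<forall>g\<in>\<G>. \<bar>(\<integral>X. g X * f_mix \<mu> X \<xi>0 \<partial>\<mu>) - (\<integral>X. g X * f_mix \<mu> X \<xi> \<partial>\<mu>)\<bar> < \<epsilon>} \<subseteq> U"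
    using U unfolding weak_nbhd_def by blast
  \<comment> \<open>Continuity and boundedness of a test function are known only on the manifold;
    cutting off there gives a globally bounded Borel function.\<close>
  define h where "h g X = indicator stiefel X * g X" for g :: "('n,'p) rmat \<Rightarrow> real" and X
  have h_meas: "h g \<in> borel_measurable borel" if "g \<in> \<G>" for g
    using borel_measurable_continuous_on_indicator[OF borel_stiefel, of g] \<G>(2)[OF that]
    by (simp add: h_def[abs_def])
  have h_bdd: "\<exists>B. \<forall>X. \<bar>h g X\<bar> \<le> B" if g: "g \<in> \<G>" for g
  proof -
    obtain B where "\<forall>X\<in>stiefel. \<bar>g X\<bar> \<le> B"
      using \<G>(2)[OF g] by (auto simp: bounded_iff)
    then have "\<bar>h g X\<bar> \<le> max B 0" for X
      by (auto simp: h_def indicator_def)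
    then show ?thesis by blast
  qed
  note f_meas [measurable] = borel_measurable_f_mix_fst[OF \<mu>]
  have f_pos: "0 < f_mix \<mu> X \<xi>" if "\<xi> \<in> Xi" for X and \<xi> :: "('c,'n,'p) param"
    using that by (intro f_mix_pos[OF \<mu>]) (auto simp: Xi_def)
  have int_h: "(\<integral>X. g X * f_mix \<mu> X \<xi> \<partial>\<mu>) = (if g \<in> borel_measurable borel then \<integral>X. h g X * f_mix \<mu> X \<xi> \<partial>\<mu> else 0)"
    if "g \<in> \<G>" "\<xi> \<in> Xi" for g and \<xi> :: "('c,'n,'p) param"
  proof (cases "g \<in> borel_measurable borel")
    case True
    note [measurable] = True h_meas[OF that(1)]
    have "(\<integral>X. g X * f_mix \<mu> X \<xi> \<partial>\<mu>) = (\<integral>X. h g X * f_mix \<mu> X \<xi> \<partial>\<mu>)"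
      using haar_stiefel_AE[OF \<mu>] by (intro integral_cong_AE) (auto simp: h_def elim!: eventually_mono)
    then show ?thesis using True by simp
  next
    case False
    have "\<not> integrable \<mu> (\<lambda>X. g X * f_mix \<mu> X \<xi>)"
    proof
      assume "integrable \<mu> (\<lambda>X. g X * f_mix \<mu> X \<xi>)"
      then have [measurable]: "(\<lambda>X. g X * f_mix \<mu> X \<xi>) \<in> borel_measurable borel"
        using borel_measurable_integrable measurable_cong_sets[OF haar_stiefel_sets[OF \<mu>] refl] by blast
      \<comment> \<open>Dividing by the positive measurable mixture density would recover
        measurability of \<open>g\<close>.\<close>
      have "(\<lambda>X. g X * f_mix \<mu> X \<xi> / f_mix \<mu> X \<xi>) \<in> borel_measurable borel"
        by measurable
      moreover have "g X * f_mix \<mu> X \<xi> / f_mix \<mu> X \<xi> = g X" for X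
        using f_pos[OF that(2), of X] by simp
      ultimately show False
        using False by simp
    qed
    then show ?thesis
      using False by (simp add: not_integrable_integral_eq)
  qed
  \<comment> \<open>Including both signs turns the two-sided deviation into one-sided ones.\<close>
  define T where "T = h ` (\<G> \<inter> borel_measurable borel) \<union> (\<lambda>g X. - h g X) ` (\<G> \<inter> borel_measurable borel)"
  show thesis
  proof (rule that[OF _ \<epsilon>])
    show "finite T"
      using \<G>(1) by (simp add: T_def)
    show "t \<in> borel_measurable borel" if "t \<in> T" for t
      using that h_meas by (auto simp: T_def)
    show "\<exists>B. \<forall>X. \<bar>t X\<bar> \<le> B" if "t \<in> T" for t
      using that h_bdd by (auto simp: T_def)
    show "Xi - U \<subseteq> (\<Union>t\<in>T. {\<xi> \<in> Xi. (\<integral>X. t X * f_mix \<mu> X \<xi>0 \<partial>\<mu>) + \<epsilon> \<le> (\<integral>X. t X * f_mix \<mu> X \<xi> \<partial>\<mu>)})"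
    proof
      fix \<xi> assume \<xi>: "\<xi> \<in> Xi - U"
      then have "\<not> (\<forall>g\<in>\<G>. \<bar>(\<integral>X. g X * f_mix \<mu> X \<xi>0 \<partial>\<mu>) - (\<integral>X. g X * f_mix \<mu> X \<xi> \<partial>\<mu>)\<bar> < \<epsilon>)"
        using \<G>(3) by blast
      then obtain g where g: "g \<in> \<G>" "\<epsilon> \<le> \<bar>(\<integral>X. g X * f_mix \<mu> X \<xi>0 \<partial>\<mu>) - (\<integral>X. g X * f_mix \<mu> X \<xi> \<partial>\<mu>)\<bar>"
        by (auto simp: not_less)
      \<comment> \<open>For a non-measurable \<open>g\<close> both integrals are 0, and a deviation
        of at least \<open>\<epsilon> > 0\<close> is impossible.\<close>
      then have g': "g \<in> borel_measurable borel"
          "\<epsilon> \<le> \<bar>(\<integral>X. h g X * f_mix \<mu> X \<xi>0 \<partial>\<mu>) - (\<integral>X. h g X * f_mix \<mu> X \<xi> \<partial>\<mu>)\<bar>"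
        using \<xi> \<xi>0 \<epsilon> by (auto simp: int_h split: if_splits)
      then consider "(\<integral>X. h g X * f_mix \<mu> X \<xi>0 \<partial>\<mu>) + \<epsilon> \<le> (\<integral>X. h g X * f_mix \<mu> X \<xi> \<partial>\<mu>)"
        | "(\<integral>X. - h g X * f_mix \<mu> X \<xi>0 \<partial>\<mu>) + \<epsilon> \<le> (\<integral>X. - h g X * f_mix \<mu> X \<xi> \<partial>\<mu>)"
        by (fastforce simp: abs_if split: if_splits)
      then show "\<xi> \<in> (\<Union>t\<in>T. {\<xi> \<in> Xi. (\<integral>X. t X * f_mix \<mu> X \<xi>0 \<partial>\<mu>) + \<epsilon> \<le> (\<integral>X. t X * f_mix \<mu> X \<xi> \<partial>\<mu>)})"
      proof cases
        case 1
        then show ?thesis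
          using g(1) g'(1) \<xi> by (intro UN_I[of "h g"]) (auto simp: T_def)
      next
        case 2
        then show ?thesis
          using g(1) g'(1) \<xi> by (intro UN_I[of "\<lambda>X. - h g X"]) (auto simp: T_def)
      qed
    qed
  qed
qed

theorem theorem5:
  fixes \<mu> :: "('n::{finite,linorder},'p::{finite,linorder}) rmat measure"
    and \<mu>p :: "('p,'p) rmat measure"
    and \<xi>0 :: "('c::{finite,linorder},'n,'p) param"
    and G :: "'c \<Rightarrow> ('n,'p) rmat" and H :: "'c \<Rightarrow> ('p,'p) rmat"
    and \<nu> :: "'c \<Rightarrow> real" and \<eta> :: "'c \<Rightarrow> 'p rvec" and \<alpha> :: "'c \<Rightarrow> real"
    and U :: "('c,'n,'p) param set"
  assumes "CARD('p) \<le> CARD('n)"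
    and "haar_stiefel \<mu>" and "haar_stiefel \<mu>p"
    and "\<xi>0 \<in> Xi"
    and "\<forall>c. 0 < \<nu> c" and "\<forall>c. \<forall>j. \<eta> c $ j < 1" and "\<forall>c. 0 < \<alpha> c"
    and "weak_nbhd \<mu> \<xi>0 U"
  shows "AE Xs in PiM UNIV (\<lambda>_::nat. true_dist \<mu> \<xi>0).
           (\<lambda>N. posterior (prior \<mu> \<mu>p G H \<nu> \<eta> \<alpha>) \<mu> \<xi>0 Xs N (Xi - U)) \<longlonglongrightarrow> 0"
proof -
  note card = assms(1) and \<mu> = assms(2,3) and \<xi>0 = assms(4)
  let ?Pr = "prior \<mu> \<mu>p G H \<nu> \<eta> \<alpha>"
  let ?L = "lik_ratio \<mu> \<xi>0 :: _ \<Rightarrow> nat \<Rightarrow> ('c,'n,'p) param \<Rightarrow> real"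
  interpret Pr: finite_measure ?Pr by (rule finite_measure_prior)
  obtain T \<epsilon> where T: "finite T" "0 < \<epsilon>" "\<And>t. t \<in> T \<Longrightarrow> t \<in> borel_measurable borel"
    "\<And>t. t \<in> T \<Longrightarrow> \<exists>B. \<forall>X. \<bar>t X\<bar> \<le> B"
    "Xi - U \<subseteq> (\<Union>t\<in>T. {\<xi> \<in> Xi. (\<integral>X. t X * f_mix \<mu> X \<xi>0 \<partial>\<mu>) + \<epsilon> \<le> (\<integral>X. t X * f_mix \<mu> X \<xi> \<partial>\<mu>)})"
    by (rule weak_nbhd_complement_cover[OF \<mu>(1) \<xi>0 assms(8)]) blast
  define A where "A t = {\<xi> \<in> (Xi :: ('c,'n,'p) param set). (\<integral>X. t X * f_mix \<mu> X \<xi>0 \<partial>\<mu>) + \<epsilon> \<le> (\<integral>X. t X * f_mix \<mu> X \<xi> \<partial>\<mu>)}" for t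
  define I where "I t Xs N = (\<integral>\<^sup>+\<xi>. indicator (A t) \<xi> * ennreal (?L Xs N \<xi>) \<partial>?Pr)" for t Xs N
  have ex_\<rho>: "\<forall>t\<in>T. \<exists>\<rho>. 0 < \<rho> \<and> \<rho> < 1 \<and> (AE Xs in PiM UNIV (\<lambda>_::nat. true_dist \<mu> \<xi>0).
      (\<lambda>N. ennreal ((1 / \<rho>) ^ N) * I t Xs N) \<longlonglongrightarrow> 0)"
  proof
    fix t assume t: "t \<in> T"
    obtain B where B: "\<And>X. \<bar>t X\<bar> \<le> B"
      using T(4)[OF t] by blast
    show "\<exists>\<rho>. 0 < \<rho> \<and> \<rho> < 1 \<and> (AE Xs in PiM UNIV (\<lambda>_::nat. true_dist \<mu> \<xi>0).
        (\<lambda>N. ennreal ((1 / \<rho>) ^ N) * I t Xs N) \<longlonglongrightarrow> 0)"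
      unfolding I_def A_def
      by (rule mixture_posterior_numerator[OF card \<mu>(1) \<xi>0 T(3)[OF t] B T(2) finite_measure_prior sets_prior[OF \<mu>]])
         blast
  qed
  obtain \<rho> where \<rho>: "\<And>t. t \<in> T \<Longrightarrow> 0 < \<rho> t" "\<And>t. t \<in> T \<Longrightarrow> \<rho> t < 1"
    "\<And>t. t \<in> T \<Longrightarrow> AE Xs in PiM UNIV (\<lambda>_::nat. true_dist \<mu> \<xi>0). (\<lambda>N. ennreal ((1 / \<rho> t) ^ N) * I t Xs N) \<longlonglongrightarrow> 0"
    using bchoice[OF ex_\<rho>] by blast
  have A_sets: "A t \<in> sets ?Pr" if "t \<in> T" for t
    unfolding A_def sets_prior[OF \<mu>] by (rule sets_separated[OF \<mu>(1) T(3)[OF that]])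
  have lik_meas: "?L Xs N \<in> borel_measurable ?Pr" for Xs N
  proof -
    have [measurable]: "f_mix \<mu> X \<in> borel_measurable ?Pr" for X
      unfolding measurable_cong_sets[OF sets_prior[OF \<mu>] refl] by (rule borel_measurable_f_mix_snd[OF \<mu>(1)])
    show ?thesis
      unfolding lik_ratio_def[abs_def] by measurable
  qed
  have lik_nonneg: "AE \<xi> in ?Pr. 0 \<le> ?L Xs N \<xi>" for Xs N
    using AE_prior_simplex
  proof eventually_elim
    case (elim \<xi>)
    then show ?case
      using f_mix_pos[OF \<mu>(1) elim] f_mix_pos[OF \<mu>(1), of \<xi>0] \<xi>0
      by (auto simp: lik_ratio_def Xi_def intro!: prod_pos divide_pos_pos less_imp_le[of 0])
  qed
  have num_nonneg: "AE \<xi> in ?Pr. 0 \<le> indicator (Xi - U) \<xi> * ?L Xs N \<xi>" for Xs N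
    using lik_nonneg[of Xs N] by eventually_elim simp
  \<comment> \<open>A union bound over the cover. A non-integrable numerator has the default value
    0, so the inequality still holds.\<close>
  have num_le: "ennreal (\<integral>\<xi>. indicator (Xi - U) \<xi> * ?L Xs N \<xi> \<partial>?Pr) \<le> (\<Sum>t\<in>T. I t Xs N)" for Xs N
  proof (cases "integrable ?Pr (\<lambda>\<xi>. indicator (Xi - U) \<xi> * ?L Xs N \<xi>)")
    case True
    note [measurable] = lik_meas
    have "ennreal (\<integral>\<xi>. indicator (Xi - U) \<xi> * ?L Xs N \<xi> \<partial>?Pr)
        = (\<integral>\<^sup>+\<xi>. ennreal (indicator (Xi - U) \<xi> * ?L Xs N \<xi>) \<partial>?Pr)"
      by (rule nn_integral_eq_integral[OF True num_nonneg, symmetric])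
    also have "\<dots> \<le> (\<integral>\<^sup>+\<xi>. (\<Sum>t\<in>T. indicator (A t) \<xi> * ennreal (?L Xs N \<xi>)) \<partial>?Pr)"
    proof (rule nn_integral_mono)
      fix \<xi>
      show "ennreal (indicator (Xi - U) \<xi> * ?L Xs N \<xi>) \<le> (\<Sum>t\<in>T. indicator (A t) \<xi> * ennreal (?L Xs N \<xi>))"
      proof (cases "\<xi> \<in> Xi - U")
        case True
        then obtain t where t: "t \<in> T" "\<xi> \<in> A t"
          using T(5) by (auto simp: A_def)
        then have "ennreal (indicator (Xi - U) \<xi> * ?L Xs N \<xi>) = indicator (A t) \<xi> * ennreal (?L Xs N \<xi>)"
          using True by simp
        also have "\<dots> \<le> (\<Sum>t\<in>T. indicator (A t) \<xi> * ennreal (?L Xs N \<xi>))"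
          using T(1) t(1) by (rule member_le_sum[rotated 2]) simp
        finally show ?thesis .
      qed simp
    qed
    also have "\<dots> = (\<Sum>t\<in>T. I t Xs N)"
      unfolding I_def using A_sets by (intro nn_integral_sum) auto
    finally show ?thesis .
  qed (simp add: not_integrable_integral_eq)
  have num_nonneg': "0 \<le> (\<integral>\<xi>. indicator (Xi - U) \<xi> * ?L Xs N \<xi> \<partial>?Pr)" for Xs N
    by (rule integral_nonneg_AE[OF num_nonneg])
  show ?thesis
  \<comment> \<open>A degenerate prior factor makes the whole prior null; every numerator is then 0.
    Otherwise the lower bound for the denominator is available.\<close>
  proof (cases "emeasure ?Pr (space ?Pr) = 0")
    case True
    have "I t Xs N = 0" for t Xs N
    proof -
      have "AE \<xi> in ?Pr. indicator (A t) \<xi> * ennreal (?L Xs N \<xi>) = 0"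
        using True by (intro AE_I[where N="space ?Pr"]) auto
      then show ?thesis
        unfolding I_def by (subst nn_integral_cong_AE[of _ "\<lambda>_. 0"]) auto
    qed
    then have "(\<integral>\<xi>. indicator (Xi - U) \<xi> * ?L Xs N \<xi> \<partial>?Pr) = 0" for Xs N
      using num_le[of Xs N] num_nonneg'[of Xs N] by (simp add: ennreal_eq_0_iff)
    then show ?thesis
      by (simp add: posterior_def)
  next
    case False
    \<comment> \<open>The denominator bound is taken at the rate \<open>\<rho> t\<close> of each
      numerator, so each term of the quotient is at most a constant times
      \<open>(1 / \<rho> t) ^ N * I t Xs N\<close>, which is known to vanish.\<close>
    have ex_k: "\<forall>t\<in>T. \<exists>k. 0 < k \<and> (\<forall>Xs N. (\<forall>i. Xs i \<in> stiefel) \<longrightarrow> integrable ?Pr (?L Xs N) \<longrightarrow>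
        \<rho> t ^ N * k \<le> (\<integral>\<xi>. ?L Xs N \<xi> \<partial>?Pr))"
    proof
      fix t assume t: "t \<in> T"
      show "\<exists>k. 0 < k \<and> (\<forall>Xs N. (\<forall>i. Xs i \<in> stiefel) \<longrightarrow> integrable ?Pr (?L Xs N) \<longrightarrow>
          \<rho> t ^ N * k \<le> (\<integral>\<xi>. ?L Xs N \<xi> \<partial>?Pr))"
        by (rule posterior_denominator[OF \<mu> \<xi>0 \<rho>(1,2)[OF t] False]) blast
    qed
    obtain k where k: "\<And>t. t \<in> T \<Longrightarrow> 0 < k t"
      "\<And>t Xs N. t \<in> T \<Longrightarrow> \<forall>i. Xs i \<in> stiefel \<Longrightarrow> integrable ?Pr (?L Xs N) \<Longrightarrow>
        \<rho> t ^ N * k t \<le> (\<integral>\<xi>. ?L Xs N \<xi> \<partial>?Pr)"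
      using bchoice[OF ex_k] by blast
    have post_nonneg: "0 \<le> posterior ?Pr \<mu> \<xi>0 Xs N (Xi - U)" for Xs N
      unfolding posterior_def
      by (intro divide_nonneg_nonneg num_nonneg' integral_nonneg_AE lik_nonneg)
    \<comment> \<open>If the likelihood ratio is not integrable, the denominator is 0 by default and
      so is the posterior.\<close>
    have post_le: "ennreal (posterior ?Pr \<mu> \<xi>0 Xs N (Xi - U))
        \<le> (\<Sum>t\<in>T. ennreal (1 / k t) * (ennreal ((1 / \<rho> t) ^ N) * I t Xs N))"
      if Xs: "\<forall>i. Xs i \<in> stiefel" for Xs N
    proof (cases "integrable ?Pr (?L Xs N)")
      case True
      let ?D = "\<integral>\<xi>. ?L Xs N \<xi> \<partial>?Pr"
      have D: "0 \<le> ?D"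
        by (intro integral_nonneg_AE lik_nonneg)
      have "ennreal (posterior ?Pr \<mu> \<xi>0 Xs N (Xi - U))
          = ennreal (1 / ?D) * ennreal (\<integral>\<xi>. indicator (Xi - U) \<xi> * ?L Xs N \<xi> \<partial>?Pr)"
        unfolding posterior_def using D num_nonneg' by (simp flip: ennreal_mult)
      also have "\<dots> \<le> ennreal (1 / ?D) * (\<Sum>t\<in>T. I t Xs N)"
        by (intro mult_left_mono num_le) simp
      also have "\<dots> = (\<Sum>t\<in>T. ennreal (1 / ?D) * I t Xs N)"
        by (rule sum_distrib_left)
      also have "\<dots> \<le> (\<Sum>t\<in>T. (ennreal (1 / k t) * ennreal ((1 / \<rho> t) ^ N)) * I t Xs N)"
      proof (intro sum_mono mult_right_mono)
        fix t assume t: "t \<in> T"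
        have pos: "0 < \<rho> t ^ N * k t"
          using \<rho>(1)[OF t] k(1)[OF t] by simp
        have "1 / ?D \<le> 1 / (\<rho> t ^ N * k t)"
          by (rule divide_left_mono[OF k(2)[OF t Xs True]])
             (use pos k(2)[OF t Xs True] in \<open>auto intro: mult_pos_pos less_le_trans\<close>)
        also have "\<dots> = 1 / k t * (1 / \<rho> t) ^ N"
          by (simp add: power_one_over)
        finally show "ennreal (1 / ?D) \<le> ennreal (1 / k t) * ennreal ((1 / \<rho> t) ^ N)"
          using \<rho>(1)[OF t] k(1)[OF t] by (subst ennreal_mult[symmetric]) (auto intro: ennreal_leI)
      qed simp
      finally show ?thesis
        by (simp add: mult.assoc)
    qed (simp add: posterior_def not_integrable_integral_eq)
    interpret P: prob_space "true_dist \<mu> \<xi>0"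
      by (rule prob_space_true_dist[OF card \<mu>(1) \<xi>0])
    have [measurable]: "(\<lambda>X. f_mix \<mu> X \<xi>0) \<in> borel_measurable \<mu>"
      unfolding measurable_cong_sets[OF haar_stiefel_sets[OF \<mu>(1)] refl]
      by (rule borel_measurable_f_mix_fst[OF \<mu>(1)])
    have "AE X in true_dist \<mu> \<xi>0. X \<in> stiefel"
      unfolding true_dist_def using haar_stiefel_AE[OF \<mu>(1)]
      by (subst AE_density) (auto elim!: eventually_mono)
    \<comment> \<open>The denominator bound asks for samples on the manifold; countably many null
      sets are discarded.\<close>
    then have "AE Xs in PiM UNIV (\<lambda>_::nat. true_dist \<mu> \<xi>0). \<forall>i. Xs i \<in> stiefel"
      by (subst AE_all_countable) (auto intro!: AE_PiM_component P.prob_space_axioms)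
    moreover have "AE Xs in PiM UNIV (\<lambda>_::nat. true_dist \<mu> \<xi>0). \<forall>t\<in>T. (\<lambda>N. ennreal ((1 / \<rho> t) ^ N) * I t Xs N) \<longlonglongrightarrow> 0"
      using T(1) \<rho>(3) by (rule AE_finite_allI)
    ultimately show ?thesis
    proof eventually_elim
      case (elim Xs)
      have "(\<lambda>N. \<Sum>t\<in>T. ennreal (1 / k t) * (ennreal ((1 / \<rho> t) ^ N) * I t Xs N)) \<longlonglongrightarrow> (\<Sum>t\<in>T. ennreal (1 / k t) * 0)"
        using elim(2) by (intro tendsto_sum tendsto_mult_ennreal tendsto_const) auto
      then have lim: "(\<lambda>N. \<Sum>t\<in>T. ennreal (1 / k t) * (ennreal ((1 / \<rho> t) ^ N) * I t Xs N)) \<longlonglongrightarrow> 0"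
        by (simp only: mult_zero_right sum.neutral_const)
      have "(\<lambda>N. ennreal (posterior ?Pr \<mu> \<xi>0 Xs N (Xi - U))) \<longlonglongrightarrow> 0"
      proof (rule tendsto_sandwich[OF _ _ tendsto_const lim])
        show "\<forall>\<^sub>F N in sequentially. ennreal (posterior ?Pr \<mu> \<xi>0 Xs N (Xi - U))
            \<le> (\<Sum>t\<in>T. ennreal (1 / k t) * (ennreal ((1 / \<rho> t) ^ N) * I t Xs N))"
          by (intro always_eventually allI post_le elim(1))
      qed simp
      then show ?case
        using post_nonneg by (subst (asm) ennreal_tendsto_0_iff) auto
    qed
  qed
qed

end
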